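(* Let $D$ be a compact metric space with metric $d$, $\lambda$ a Radon measure on $D$ and $\mu>0$. Let $\tilde\eta$ be a version of the unordered stationary FIFM matching process on $D$, i.e. the random finite configuration in $D\times\{\mathtt R,\mathtt B\}$ obtained by forgetting the order of the particles in the steady state; it has the density $\tilde\pi$ given in the context with respect to the Poisson point process on $D\times\{\mathtt R,\mathtt B\}$ with intensity $\bar\lambda$. Order configurations by: $\xi\ge\gamma$ if and only if $\xi^{\mathtt R}\supseteq\gamma^{\mathtt R}$ and $\xi^{\mathtt B}\subseteq\gamma^{\mathtt B}$. Then the stationary measure is positively associated: for any two functions $f,g$ on configurations that are increasing with respect to this order, $$\mathbb E[f(\tilde\eta)g(\tilde\eta)]\ \ge\ \mathbb E[f(\tilde\eta)]\,\mathbb E[g(\tilde\eta)].$$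
   Context: $\mathbf C=\{\mathtt R,\mathtt B\}$ (red and blue), $\bar{\mathtt R}=\mathtt B$, $\bar{\mathtt B}=\mathtt R$; $\bar\lambda=\lambda\otimes m_c$ on $D\times\mathbf C$ with $m_c$ the counting measure on $\mathbf C$. For $x=(p_x,c_x)\in D\times\mathbf C$, $N(x)=\{y\in D\times\mathbf C:c_y=\bar c_x,\ d(p_x,p_y)<1\}$, and $N(A)=\bigcup_{x\in A}N(x)$. A configuration is a finite collection $\gamma$ of points of $D\times\mathbf C$; $\gamma^{\mathtt R},\gamma^{\mathtt B}$ are its red and blue points; it is valid if $\gamma\cap N(\gamma)=\emptyset$. The density is $$\tilde\pi(\{x_1,\dots,x_n\})=K\,\mathbf 1(\{x_1,\dots,x_n\}\text{ is valid})\sum_{(X_1,\dots,X_n)}\prod_{i=1}^n\frac{1}{\bar\lambda(N(\{X_1,\dots,X_i\}))+i\mu},$$ where the sum is over all permutations $(X_1,\dots,X_n)$ of $x_1,\dots,x_n$, $\tilde\pi(\emptyset)=K$, and $K$ is a normalizing constant. The FIFM (first-in-first-match) matching process: red and blue particles arrive in $D$ as independent Poisson processes with intensity $\lambda$ per unit time; an arriving particle is matched with the earliest-arrived present particle of opposite color within distance less than $1$, if there is one, and both disappear; otherwise it is added as the last element of the ordered list of present particles; in addition each present particle leaves on its own at rate $\mu$. This process has a unique stationary distribution. *)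

theory Defs
  imports "HOL-Probability.Probability" "HOL-Combinatorics.Permutations"
begin

definition radon_measure_on :: "'a::metric_space set \<Rightarrow> 'a measure \<Rightarrow> bool" where
  "radon_measure_on D lam \<longleftrightarrow>
     sets lam = sets (restrict_space borel D) \<and>
     (\<forall>K. K \<subseteq> D \<and> compact K \<longrightarrow> emeasure lam K < \<infinity>) \<and>
     (\<forall>A\<in>sets lam. emeasure lam A = (SUP K\<in>{K. K \<subseteq> A \<and> compact K}. emeasure lam K))"


datatype color = Red | Blue

fun opp :: "color \<Rightarrow> color" where
  "opp Red = Blue"
| "opp Blue = Red"

definition colored :: "'a measure \<Rightarrow> ('a \<times> color) measure" where
  "colored lam = lam \<Otimes>\<^sub>M count_space UNIV"

definition nbhd :: "'a::metric_space set \<Rightarrow> 'a \<times> color \<Rightarrow> ('a \<times> color) set" where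
  "nbhd D x = {y \<in> D \<times> UNIV. snd y = opp (snd x) \<and> dist (fst x) (fst y) < 1}"

definition nbhds :: "'a::metric_space set \<Rightarrow> ('a \<times> color) set \<Rightarrow> ('a \<times> color) set" where
  "nbhds D A = (\<Union>x\<in>A. nbhd D x)"


text \<open>Configurations are finite multisets, because \<open>\<lambda>\<close> may have atoms and several particles may then
  sit at the same point. They carry the \<open>\<sigma>\<close>-algebra generated by the counting maps.\<close>

definition count_in :: "'b set \<Rightarrow> 'b multiset \<Rightarrow> nat" where
  "count_in A \<gamma> = size (filter_mset (\<lambda>x. x \<in> A) \<gamma>)"

definition configurations :: "'b measure \<Rightarrow> 'b multiset set" where
  "configurations M = {\<gamma>. set_mset \<gamma> \<subseteq> space M}"

definition config_space :: "'b measure \<Rightarrow> 'b multiset measure" where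
  "config_space M = sigma (configurations M)
     {{\<gamma> \<in> configurations M. count_in A \<gamma> = k} | A k. A \<in> sets M}"

text \<open>Point process with independent Poisson counts on disjoint sets; the intensity measure \<open>M\<close> is
  finite in all uses.\<close>

definition poisson_point_process :: "'b measure \<Rightarrow> 'b multiset measure \<Rightarrow> bool" where
  "poisson_point_process M P \<longleftrightarrow>
     prob_space P \<and> sets P = sets (config_space M) \<and>
     (\<forall>A\<in>sets M. \<forall>k. measure P {\<gamma> \<in> space P. count_in A \<gamma> = k}
        = exp (- measure M A) * measure M A ^ k / fact k) \<and>
     (\<forall>(I :: nat set) A. finite I \<and> A ` I \<subseteq> sets M \<and> disjoint_family_on A I \<longrightarrow>
        prob_space.indep_vars P (\<lambda>_. count_space UNIV) (\<lambda>i. count_in (A i)) I)"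

definition color_part :: "color \<Rightarrow> ('a \<times> color) multiset \<Rightarrow> ('a \<times> color) multiset" where
  "color_part c \<gamma> = filter_mset (\<lambda>x. snd x = c) \<gamma>"

definition config_ge :: "('a \<times> color) multiset \<Rightarrow> ('a \<times> color) multiset \<Rightarrow> bool" where
  "config_ge \<xi> \<gamma> \<longleftrightarrow>
     color_part Red \<gamma> \<subseteq># color_part Red \<xi> \<and> color_part Blue \<xi> \<subseteq># color_part Blue \<gamma>"

definition increasing_on :: "('a \<times> color) multiset set \<Rightarrow> (('a \<times> color) multiset \<Rightarrow> real) \<Rightarrow> bool" where
  "increasing_on S f \<longleftrightarrow> (\<forall>\<xi>\<in>S. \<forall>\<gamma>\<in>S. config_ge \<xi> \<gamma> \<longrightarrow> f \<gamma> \<le> f \<xi>)"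


definition valid :: "'a::metric_space set \<Rightarrow> ('a \<times> color) multiset \<Rightarrow> bool" where
  "valid D \<gamma> \<longleftrightarrow> set_mset \<gamma> \<inter> nbhds D (set_mset \<gamma>) = {}"

definition order_weight ::
  "'a::metric_space set \<Rightarrow> 'a measure \<Rightarrow> real \<Rightarrow> ('a \<times> color) list \<Rightarrow> real" where
  "order_weight D lam \<mu> xs =
     (\<Prod>i=1..length xs. 1 / (measure (colored lam) (nbhds D (set (take i xs))) + real i * \<mu>))"

definition permutation_sum ::
  "'a::metric_space set \<Rightarrow> 'a measure \<Rightarrow> real \<Rightarrow> ('a \<times> color) list \<Rightarrow> real" where
  "permutation_sum D lam \<mu> xs =
     (\<Sum>p | p permutes {..<length xs}. order_weight D lam \<mu> (permute_list p xs))"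

lemma permutation_sum_cong:
  assumes "mset xs = mset ys"
  shows "permutation_sum D lam \<mu> xs = permutation_sum D lam \<mu> ys"
proof -
  obtain q where q: "q permutes {..<length ys}" "permute_list q ys = xs"
    using assms by (rule mset_eq_permutation)
  have len: "length xs = length ys"
    using assms by (rule mset_eq_length)
  have "permutation_sum D lam \<mu> xs
      = (\<Sum>p | p permutes {..<length ys}. order_weight D lam \<mu> (permute_list (q \<circ> p) ys))"
    unfolding permutation_sum_def len
    by (rule sum.cong) (auto simp: permute_list_compose q(2))
  also have "\<dots> = permutation_sum D lam \<mu> ys"
    unfolding permutation_sum_def
    by (rule setum_permutations_compose_left[OF q(1), symmetric])
  finally show ?thesis .
qed

text \<open>The sum runs over all \<open>n!\<close> orderings of the \<open>n\<close> particles, equal points being told apart. The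
  enumeration picked by \<open>SOME\<close> is irrelevant by \<open>permutation_sum_cong\<close>.\<close>

definition fifm_density ::
  "'a::metric_space set \<Rightarrow> 'a measure \<Rightarrow> real \<Rightarrow> real \<Rightarrow> ('a \<times> color) multiset \<Rightarrow> real" where
  "fifm_density D lam \<mu> K \<gamma> =
     K * (if valid D \<gamma> then permutation_sum D lam \<mu> (SOME xs. mset xs = \<gamma>) else 0)"


text \<open>Ordered states of the process: lists of particles, earliest arrival first.\<close>

definition list_space :: "'b measure \<Rightarrow> 'b list measure" where
  "list_space M = sigma (lists (space M)) (listset ` lists (sets M))"

definition arrive ::
  "'a::metric_space set \<Rightarrow> 'a \<times> color \<Rightarrow> ('a \<times> color) list \<Rightarrow> ('a \<times> color) list" where
  "arrive D y xs = (case List.extract (\<lambda>x. y \<in> nbhd D x) xs of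
       None \<Rightarrow> xs @ [y]
     | Some (us, _, vs) \<Rightarrow> us @ vs)"

definition depart :: "nat \<Rightarrow> 'b list \<Rightarrow> 'b list" where
  "depart i xs = take i xs @ drop (Suc i) xs"

definition total_rate :: "'a measure \<Rightarrow> real \<Rightarrow> ('a \<times> color) list \<Rightarrow> real" where
  "total_rate lam \<mu> xs = measure (colored lam) (space (colored lam)) + real (length xs) * \<mu>"

definition jump_integral ::
  "'a::metric_space set \<Rightarrow> 'a measure \<Rightarrow> real \<Rightarrow> (('a \<times> color) list \<Rightarrow> ennreal)
    \<Rightarrow> ('a \<times> color) list \<Rightarrow> ennreal" where
  "jump_integral D lam \<mu> h xs =
     (\<integral>\<^sup>+ y. h (arrive D y xs) \<partial>colored lam) + (\<Sum>i<length xs. ennreal \<mu> * h (depart i xs))"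

text \<open>\<open>fifm_transition_upto D lam \<mu> n t A xs\<close> is the probability that the jump process started in
  \<open>xs\<close> makes fewer than \<open>n\<close> jumps up to time \<open>t\<close> and is in \<open>A\<close> at time \<open>t\<close>, obtained by conditioning
  on the first jump.\<close>

primrec fifm_transition_upto ::
  "'a::metric_space set \<Rightarrow> 'a measure \<Rightarrow> real \<Rightarrow> nat \<Rightarrow> real \<Rightarrow> ('a \<times> color) list set
    \<Rightarrow> ('a \<times> color) list \<Rightarrow> ennreal" where
  "fifm_transition_upto D lam \<mu> 0 t A xs = 0"
| "fifm_transition_upto D lam \<mu> (Suc n) t A xs =
     ennreal (exp (- total_rate lam \<mu> xs * t)) * indicator A xs +
     (\<integral>\<^sup>+ s. ennreal (exp (- total_rate lam \<mu> xs * s)) *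
        jump_integral D lam \<mu> (fifm_transition_upto D lam \<mu> n (t - s) A) xs * indicator {0..t} s
      \<partial>lborel)"

definition fifm_transition ::
  "'a::metric_space set \<Rightarrow> 'a measure \<Rightarrow> real \<Rightarrow> real \<Rightarrow> ('a \<times> color) list set
    \<Rightarrow> ('a \<times> color) list \<Rightarrow> ennreal" where
  "fifm_transition D lam \<mu> t A xs = (SUP n. fifm_transition_upto D lam \<mu> n t A xs)"

definition fifm_stationary ::
  "'a::metric_space set \<Rightarrow> 'a measure \<Rightarrow> real \<Rightarrow> ('a \<times> color) list measure \<Rightarrow> bool" where
  "fifm_stationary D lam \<mu> \<nu> \<longleftrightarrow>
     prob_space \<nu> \<and> sets \<nu> = sets (list_space (colored lam)) \<and>
     (\<forall>t\<ge>0. \<forall>A\<in>sets \<nu>. (\<integral>\<^sup>+ xs. fifm_transition D lam \<mu> t A xs \<partial>\<nu>) = emeasure \<nu> A)"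

end

(* For fixed mu and lam, let w(A) = lam(N(A)) + |A| mu. The sum over orderings Phi satisfies the balance
   equation w(A) Phi(A) = sum_{x in A} Phi(A - x). Since w is submodular, induction on |A| shows that Phi
   is log-supermodular; since w is additive over red and blue particles, Phi factors into a red and a
   blue part. Together with the validity constraint this makes the density log-supermodular for the order
   "more red, less blue".

   To pass from finite lattices to the Poisson process, take two independent copies. Given their
   superposition, each particle belongs to either copy with probability 1/2, independently. Writing the
   covariance as half the expectation of (f(a) - f(b)) (g(a) - g(b)) over two copies a, b weighted by
   the densities, the conditional expectation given the superposition is a sum over a Boolean lattice,
   where the FKG inequality applies: the first factor has mean zero by symmetry, so no discretisation
   and no limit is needed. *)

theory Submission
  imports Defs
begin

section \<open>Correlation inequalities on finite Boolean lattices\<close>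

text \<open>The Poisson process is known only through its counts on disjoint sets, whereas the
  density sums over orderings of the particles. Both have to meet in the \<sigma>-algebra generated
  by counts. Finite partitions of the space do this: on a partition, events become sets of count
  vectors, and Poisson probabilities become explicit products. The conditional law of two copies
  given their superposition is never constructed. The Mecke formula, applied to both copies, peels
  off one particle at a time. It acts on the integrand exactly as one more labelled point acts on
  the sum over all splittings, so an inequality between these sums passes to the integrals. Validity
  is not preserved by unions, since red and blue particles exclude each other. It is preserved by
  the joins and meets of "more red, less blue": a red-blue pair in either of them already occurs in
  one of the two given configurations. Working with index sets of labelled points makes joins and
  meets plain set operations, even when \<open>lam\<close> has atoms and particles coincide.\<close>

lemma sum_Pow_insert:
  fixes f :: "'i set \<Rightarrow> 'b::comm_monoid_add"
  assumes "finite I" "i \<notin> I"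
  shows "sum f (Pow (insert i I)) = (\<Sum>S\<in>Pow I. f S + f (insert i S))"
proof -
  have "inj_on (insert i) (Pow I)"
    using assms(2) by (auto simp: inj_on_def)
  moreover have "Pow I \<inter> insert i ` Pow I = {}"
    using assms(2) by auto
  ultimately show ?thesis
    using assms(1) by (simp add: Pow_insert sum.union_disjoint sum.reindex sum.distrib)
qed

text \<open>The one-point case of the Ahlswede-Daykin inequality. Put \<open>p = c1 * d0\<close>.
  Both cross terms are at most \<open>p\<close>, and their product is at most
  \<open>p * (c0 * d1)\<close>; expanding \<open>(p - a0 * b1) * (p - a1 * b0)\<close>, which is
  nonnegative, and dividing by \<open>p\<close> bounds their sum by
  \<open>p + c0 * d1\<close>.\<close>

lemma four_numbers:
  fixes a0 a1 b0 b1 c0 c1 d0 d1 :: real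
  assumes nonneg: "0 \<le> a0" "0 \<le> a1" "0 \<le> b0" "0 \<le> b1" "0 \<le> c0" "0 \<le> c1" "0 \<le> d0" "0 \<le> d1"
    and "a0 * b0 \<le> c0 * d0" "a0 * b1 \<le> c1 * d0" "a1 * b0 \<le> c1 * d0" "a1 * b1 \<le> c1 * d1"
  shows "(a0 + a1) * (b0 + b1) \<le> (c0 + c1) * (d0 + d1)"
proof (cases "c1 * d0 = 0")
  case True
  then have "a0 * b1 \<le> 0" "a1 * b0 \<le> 0"
    using assms(10,11) by (simp_all only: True)
  moreover have "0 \<le> c0 * d1" "0 \<le> c1 * d0" using nonneg by simp_all
  ultimately show ?thesis using assms(9,12) by (simp add: distrib_left distrib_right)
next
  case False
  define p where "p = c1 * d0"
  have "p > 0" using False nonneg by (simp add: p_def less_le)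
  have "(a0 * b1) * (a1 * b0) \<le> (c0 * d1) * p"
    using mult_mono[OF \<open>a0 * b0 \<le> c0 * d0\<close> \<open>a1 * b1 \<le> c1 * d1\<close>] nonneg
    by (simp add: p_def mult_ac)
  moreover have "0 \<le> (p - a0 * b1) * (p - a1 * b0)"
    using assms by (intro mult_nonneg_nonneg) (simp_all add: p_def)
  ultimately have "(a0 * b1 + a1 * b0) * p \<le> (p + c0 * d1) * p"
    by (simp add: algebra_simps)
  then have "a0 * b1 + a1 * b0 \<le> p + c0 * d1"
    using \<open>p > 0\<close> by simp
  with assms show ?thesis by (simp add: algebra_simps p_def)
qed

text \<open>The Ahlswede-Daykin theorem. Summing out one index \<open>i\<close> replaces each
  function by \<open>S \<mapsto> a S + a (insert i S)\<close>; \<open>four_numbers\<close> says that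
  the four new functions satisfy the hypothesis on the smaller lattice.\<close>

theorem four_functions:
  fixes a b c d :: "'i set \<Rightarrow> real"
  assumes "finite I"
    and "\<And>S. S \<subseteq> I \<Longrightarrow> 0 \<le> a S" "\<And>S. S \<subseteq> I \<Longrightarrow> 0 \<le> b S"
    and "\<And>S. S \<subseteq> I \<Longrightarrow> 0 \<le> c S" "\<And>S. S \<subseteq> I \<Longrightarrow> 0 \<le> d S"
    and "\<And>S T. S \<subseteq> I \<Longrightarrow> T \<subseteq> I \<Longrightarrow> a S * b T \<le> c (S \<union> T) * d (S \<inter> T)"
  shows "sum a (Pow I) * sum b (Pow I) \<le> sum c (Pow I) * sum d (Pow I)"
  using assms
proof (induction I arbitrary: a b c d rule: finite_induct)
  case empty
  show ?case using empty(5)[of "{}" "{}"] by simp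
next
  case (insert i I)
  have ins: "insert i S \<subseteq> insert i I" "S \<subseteq> insert i I" if "S \<subseteq> I" for S
    using that by auto
  have step: "(a S + a (insert i S)) * (b T + b (insert i T))
      \<le> (c (S \<union> T) + c (insert i (S \<union> T))) * (d (S \<inter> T) + d (insert i (S \<inter> T)))"
    if "S \<subseteq> I" "T \<subseteq> I" for S T
  proof (rule four_numbers)
    note ins' = ins[OF that(1)] ins[OF that(2)]
    have [simp]: "i \<notin> S" "i \<notin> T" using that insert(2) by auto
    show "a S * b T \<le> c (S \<union> T) * d (S \<inter> T)"
      "a S * b (insert i T) \<le> c (insert i (S \<union> T)) * d (S \<inter> T)"
      "a (insert i S) * b T \<le> c (insert i (S \<union> T)) * d (S \<inter> T)"
      "a (insert i S) * b (insert i T) \<le> c (insert i (S \<union> T)) * d (insert i (S \<inter> T))"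
      using insert.prems(5)[of S T] insert.prems(5)[of S "insert i T"]
        insert.prems(5)[of "insert i S" T] insert.prems(5)[of "insert i S" "insert i T"] ins'
      by simp_all
    have "S \<union> T \<subseteq> I" "S \<inter> T \<subseteq> I" using that by auto
    note ins'' = ins[OF this(1)] ins[OF this(2)]
    show "0 \<le> a S" "0 \<le> a (insert i S)" "0 \<le> b T" "0 \<le> b (insert i T)"
      "0 \<le> c (S \<union> T)" "0 \<le> c (insert i (S \<union> T))" "0 \<le> d (S \<inter> T)" "0 \<le> d (insert i (S \<inter> T))"
      using insert.prems(1-4) ins' ins'' by blast+
  qed
  show ?case
    unfolding sum_Pow_insert[OF insert(1,2)]
    by (rule insert.IH) (use step insert.prems(1-4) ins in auto)
qed

text \<open>Both observables are shifted to be nonnegative on the finite lattice; the shift cancels.\<close>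

theorem fkg_Pow:
  fixes w F G :: "'i set \<Rightarrow> real"
  assumes I: "finite I" and w: "\<And>S. S \<subseteq> I \<Longrightarrow> 0 \<le> w S"
    and lattice: "\<And>S T. S \<subseteq> I \<Longrightarrow> T \<subseteq> I \<Longrightarrow> w S * w T \<le> w (S \<union> T) * w (S \<inter> T)"
    and F: "\<And>S T. S \<subseteq> T \<Longrightarrow> T \<subseteq> I \<Longrightarrow> F S \<le> F T"
    and G: "\<And>S T. S \<subseteq> T \<Longrightarrow> T \<subseteq> I \<Longrightarrow> G S \<le> G T"
  shows "(\<Sum>S\<in>Pow I. w S * F S) * (\<Sum>S\<in>Pow I. w S * G S)
    \<le> (\<Sum>S\<in>Pow I. w S * F S * G S) * (\<Sum>S\<in>Pow I. w S)"
proof -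
  define F' where "F' S = F S - F {}" for S
  define G' where "G' S = G S - G {}" for S
  have nonneg: "0 \<le> F' S" "0 \<le> G' S" if "S \<subseteq> I" for S
    using F[of "{}" S] G[of "{}" S] that by (auto simp: F'_def G'_def)
  have "(\<Sum>S\<in>Pow I. w S * F' S) * (\<Sum>S\<in>Pow I. w S * G' S)
      \<le> (\<Sum>S\<in>Pow I. w S * F' S * G' S) * (\<Sum>S\<in>Pow I. w S)"
  proof (rule four_functions[OF I])
    fix S T assume ST: "S \<subseteq> I" "T \<subseteq> I"
    have "F' S * G' T \<le> F' (S \<union> T) * G' (S \<union> T)"
      using ST nonneg by (intro mult_mono) (auto simp: F'_def G'_def intro: F G)
    moreover have "0 \<le> F' S * G' T" and "0 \<le> w (S \<union> T) * w (S \<inter> T)"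
      using ST nonneg by (auto intro!: mult_nonneg_nonneg w)
    ultimately have "(w S * w T) * (F' S * G' T)
        \<le> (w (S \<union> T) * w (S \<inter> T)) * (F' (S \<union> T) * G' (S \<union> T))"
      using mult_mono[OF lattice[OF ST]] by blast
    then show "w S * F' S * (w T * G' T) \<le> w (S \<union> T) * F' (S \<union> T) * G' (S \<union> T) * w (S \<inter> T)"
      by (simp add: mult_ac)
  qed (use w nonneg in auto)
  moreover have eqs: "(\<Sum>S\<in>Pow I. w S * F' S)
      = (\<Sum>S\<in>Pow I. w S * F S) - F {} * (\<Sum>S\<in>Pow I. w S)"
    "(\<Sum>S\<in>Pow I. w S * G' S) = (\<Sum>S\<in>Pow I. w S * G S) - G {} * (\<Sum>S\<in>Pow I. w S)"
    "(\<Sum>S\<in>Pow I. w S * F' S * G' S) = (\<Sum>S\<in>Pow I. w S * F S * G S)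
      - G {} * (\<Sum>S\<in>Pow I. w S * F S) - F {} * (\<Sum>S\<in>Pow I. w S * G S)
      + F {} * G {} * (\<Sum>S\<in>Pow I. w S)"
    by (simp_all add: F'_def G'_def algebra_simps sum.distrib sum_subtractf sum_distrib_left)
  ultimately show ?thesis
    unfolding eqs by (simp add: algebra_simps)
qed

section \<open>Measurability on the space of configurations\<close>

lemma sum_mset_sum_swap:
  "(\<Sum>x\<in>#A. \<Sum>j\<in>J. f j x) = (\<Sum>j\<in>J. \<Sum>x\<in>#A. f j x :: 'b::comm_monoid_add)"
  by (induction A) (simp_all add: sum.distrib)

lemma sum_mset_suminf_ennreal:
  "(\<Sum>x\<in>#A. \<Sum>i. f i x) = (\<Sum>i. \<Sum>x\<in>#A. f i x :: ennreal)"
  by (induction A) (simp_all add: suminf_add)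

lemma sum_mset_SUP_ennreal:
  fixes U :: "nat \<Rightarrow> 'b \<Rightarrow> ennreal"
  assumes "\<And>x. incseq (\<lambda>i. U i x)"
  shows "(\<Sum>x\<in>#A. SUP i. U i x) = (SUP i. \<Sum>x\<in>#A. U i x)"
proof (induction A)
  case (add x A)
  have "incseq (\<lambda>i. \<Sum>x\<in>#A. U i x)"
    using assms by (auto simp: incseq_def intro: sum_mset_mono)
  then show ?case
    using add assms by (simp add: ennreal_SUP_add)
qed simp

lemma sum_mset_const_mult:
  "(\<Sum>x\<in>#A. c) = of_nat (size A) * (c :: 'b::semiring_1)"
  by (induction A) (simp_all add: algebra_simps)

lemma count_in_empty [simp]: "count_in A {#} = 0"
  by (simp add: count_in_def)

lemma count_in_add_mset [simp]:
  "count_in A (add_mset x \<gamma>) = (if x \<in> A then Suc (count_in A \<gamma>) else count_in A \<gamma>)"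
  by (simp add: count_in_def)

lemma count_in_UN:
  assumes "finite J" "disjoint_family_on B J"
  shows "count_in (\<Union>j\<in>J. B j) \<gamma> = (\<Sum>j\<in>J. count_in (B j) \<gamma>)"
proof (induction \<gamma>)
  case (add x \<gamma>)
  have "(\<Sum>j\<in>J. if x \<in> B j then 1 else 0) = (if x \<in> (\<Union>j\<in>J. B j) then 1 else (0::nat))"
  proof (cases "x \<in> (\<Union>j\<in>J. B j)")
    case True
    then obtain i where i: "i \<in> J" "x \<in> B i" by auto
    then have "x \<in> B j \<longleftrightarrow> j = i" if "j \<in> J" for j
      using assms(2) that by (auto simp: disjoint_family_on_def)
    then have "(\<Sum>j\<in>J. if x \<in> B j then 1 else 0) = (\<Sum>j\<in>J. if j = i then 1 else (0::nat))"
      by (intro sum.cong) auto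
    with True i assms(1) show ?thesis by simp
  qed (auto intro!: sum.neutral)
  moreover have "(\<Sum>j\<in>J. count_in (B j) (add_mset x \<gamma>))
      = (\<Sum>j\<in>J. count_in (B j) \<gamma>) + (\<Sum>j\<in>J. if x \<in> B j then 1 else 0)"
    unfolding sum.distrib[symmetric] by (intro sum.cong) auto
  ultimately show ?case
    using add by simp
qed simp

lemma sum_mset_indicator: "(\<Sum>x\<in>#\<gamma>. indicator A x) = (of_nat (count_in A \<gamma>) :: 'b::semiring_1)"
  by (induction \<gamma>) (auto simp: indicator_def)

lemma configurations_simps [simp]:
  "{#} \<in> configurations M"
  "add_mset x \<gamma> \<in> configurations M \<longleftrightarrow> x \<in> space M \<and> \<gamma> \<in> configurations M"
  by (auto simp: configurations_def)

lemma configurations_diff: "\<gamma> \<in> configurations M \<Longrightarrow> \<gamma> - A \<in> configurations M"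
  by (auto simp: configurations_def dest: in_diffD)

lemma configurations_member: "\<gamma> \<in> configurations M \<Longrightarrow> x \<in># \<gamma> \<Longrightarrow> x \<in> space M"
  by (auto simp: configurations_def)

lemma count_in_space: "\<gamma> \<in> configurations M \<Longrightarrow> count_in (space M) \<gamma> = size \<gamma>"
  by (induction \<gamma>) auto

lemma space_config_space [simp]: "space (config_space M) = configurations M"
  unfolding config_space_def by (rule space_measure_of) auto

lemma sets_config_space: "sets (config_space M)
    = sigma_sets (configurations M) {{\<gamma> \<in> configurations M. count_in A \<gamma> = k} | A k. A \<in> sets M}"
  unfolding config_space_def by (rule sets_measure_of) auto

lemma measurable_count_in:
  assumes "A \<in> sets M"
  shows "count_in A \<in> measurable (config_space M) (count_space UNIV)"
  unfolding measurable_count_space_eq2_countable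
  using assms by (auto simp: sets_config_space vimage_def Int_def intro!: sigma_sets.Basic)

lemma measurable_count_in_compose [measurable (raw)]:
  "f \<in> measurable N (config_space M) \<Longrightarrow> A \<in> sets M \<Longrightarrow>
    (\<lambda>\<omega>. count_in A (f \<omega>)) \<in> measurable N (count_space UNIV)"
  by (rule measurable_compose[OF _ measurable_count_in])

lemma measurable_config_space:
  assumes "f \<in> space N \<rightarrow> configurations M"
    and "\<And>A. A \<in> sets M \<Longrightarrow> (\<lambda>\<omega>. count_in A (f \<omega>)) \<in> measurable N (count_space UNIV)"
  shows "f \<in> measurable N (config_space M)"
  unfolding config_space_def
proof (rule measurable_measure_of)
  fix Y assume "Y \<in> {{\<gamma> \<in> configurations M. count_in A \<gamma> = k} | A k. A \<in> sets M}"
  then obtain A k where Y: "Y = {\<gamma> \<in> configurations M. count_in A \<gamma> = k}" "A \<in> sets M" by auto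
  then have "f -` Y \<inter> space N = (\<lambda>\<omega>. count_in A (f \<omega>)) -` {k} \<inter> space N"
    using assms(1) by auto
  then show "f -` Y \<inter> space N \<in> sets N"
    using measurable_sets[OF assms(2)[OF Y(2)]] by simp
qed (use assms(1) in auto)

lemma measurable_add_mset [measurable]:
  "(\<lambda>(x, \<gamma>). add_mset x \<gamma>) \<in> measurable (M \<Otimes>\<^sub>M config_space M) (config_space M)"
proof (rule measurable_config_space)
  fix A assume [measurable]: "A \<in> sets M"
  have "(\<lambda>\<omega>. if fst \<omega> \<in> A then Suc (count_in A (snd \<omega>)) else count_in A (snd \<omega>))
      \<in> measurable (M \<Otimes>\<^sub>M config_space M) (count_space UNIV)"
    by (intro measurable_If) (auto intro!: measurable_compose[OF measurable_count_in_compose])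
  then show "(\<lambda>\<omega>. count_in A (case \<omega> of (x, \<gamma>) \<Rightarrow> add_mset x \<gamma>))
      \<in> measurable (M \<Otimes>\<^sub>M config_space M) (count_space UNIV)"
    by (simp add: case_prod_unfold)
qed (auto simp: space_pair_measure)

lemma measurable_add_mset_compose [measurable (raw)]:
  assumes "f \<in> measurable N M" "g \<in> measurable N (config_space M)"
  shows "(\<lambda>y. add_mset (f y) (g y)) \<in> measurable N (config_space M)"
  using measurable_compose[OF measurable_Pair[OF assms] measurable_add_mset] by simp

lemma measurable_size_config [measurable]:
  "size \<in> measurable (config_space M) (count_space UNIV)"
proof -
  have "count_in (space M) \<in> measurable (config_space M) (count_space UNIV)"
    by measurable
  then show ?thesis
    by (rule measurable_cong[THEN iffD1, rotated]) (simp add: count_in_space)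
qed

section \<open>Cylinder events and finite partitions\<close>

text \<open>Cylinders with finitely many prescribed counts. Unlike the generators of
  \<open>config_space\<close>, which fix a single count, they are closed under intersection, as
  Dynkin-type arguments require.\<close>

definition count_event :: "'b measure \<Rightarrow> ('b set \<times> nat) set \<Rightarrow> 'b multiset set" where
  "count_event M W = {\<gamma> \<in> configurations M. \<forall>(A, k)\<in>W. count_in A \<gamma> = k}"

definition count_events :: "'b measure \<Rightarrow> 'b multiset set set" where
  "count_events M = {count_event M W | W. finite W \<and> fst ` W \<subseteq> sets M}"

lemma Int_stable_count_events: "Int_stable (count_events M)"
proof (rule Int_stableI)
  fix a b assume "a \<in> count_events M" "b \<in> count_events M"
  then obtain V W where "a = count_event M V" "finite V" "fst ` V \<subseteq> sets M"
    "b = count_event M W" "finite W" "fst ` W \<subseteq> sets M"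
    by (auto simp: count_events_def)
  then have "a \<inter> b = count_event M (V \<union> W)" "finite (V \<union> W)" "fst ` (V \<union> W) \<subseteq> sets M"
    by (auto simp: count_event_def ball_Un)
  then show "a \<inter> b \<in> count_events M"
    unfolding count_events_def by blast
qed

lemma sets_count_event:
  assumes "finite W" "fst ` W \<subseteq> sets M"
  shows "count_event M W \<in> sets (config_space M)"
proof -
  have "{\<gamma> \<in> space (config_space M). \<forall>w\<in>W. count_in (fst w) \<gamma> = snd w} \<in> sets (config_space M)"
  proof (rule sets.sets_Collect_finite_All[OF _ assms(1)])
    fix w assume "w \<in> W"
    then have [measurable]: "fst w \<in> sets M" using assms(2) by auto
    show "{\<gamma> \<in> space (config_space M). count_in (fst w) \<gamma> = snd w} \<in> sets (config_space M)"
      by measurable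
  qed
  then show ?thesis
    by (simp add: count_event_def case_prod_unfold)
qed

lemma configurations_count_events: "configurations M \<in> count_events M"
  unfolding count_events_def by (rule CollectI, rule exI[of _ "{}"]) (auto simp: count_event_def)

lemma count_events_Pow: "count_events M \<subseteq> Pow (configurations M)"
  by (auto simp: count_events_def count_event_def)

lemma sets_config_space_count_events:
  "sets (config_space M) = sigma_sets (configurations M) (count_events M)"
proof
  show "sets (config_space M) \<subseteq> sigma_sets (configurations M) (count_events M)"
    unfolding sets_config_space
  proof (rule sigma_sets_mono, rule subsetI)
    fix Y assume "Y \<in> {{\<gamma> \<in> configurations M. count_in A \<gamma> = k} | A k. A \<in> sets M}"
    then obtain A k where A: "A \<in> sets M" and Y: "Y = {\<gamma> \<in> configurations M. count_in A \<gamma> = k}"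
      by (elim CollectE exE conjE)
    have "count_event M {(A, k)} \<in> count_events M"
      unfolding count_events_def by (intro CollectI exI[of _ "{(A, k)}"]) (simp add: A)
    then show "Y \<in> sigma_sets (configurations M) (count_events M)"
      by (intro sigma_sets.Basic) (simp add: Y count_event_def)
  qed
  show "sigma_sets (configurations M) (count_events M) \<subseteq> sets (config_space M)"
  proof -
    have "count_events M \<subseteq> sets (config_space M)"
      by (auto simp: count_events_def intro: sets_count_event)
    from sets.sigma_sets_subset[OF this] show ?thesis by simp
  qed
qed

text \<open>Cells are numbered because the independence in \<open>poisson_point_process\<close> is
  stated for families indexed by naturals. Empty cells are allowed.\<close>

definition partition_of :: "'b measure \<Rightarrow> nat \<Rightarrow> (nat \<Rightarrow> 'b set) \<Rightarrow> bool" where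
  "partition_of M m B \<longleftrightarrow>
     (\<forall>j<m. B j \<in> sets M) \<and> disjoint_family_on B {..<m} \<and> (\<Union>j<m. B j) = space M"

text \<open>The restriction makes count vectors elements of a countable product, so an event that
  depends on \<open>counts\<close> is a countable union of atoms.\<close>

definition counts :: "nat \<Rightarrow> (nat \<Rightarrow> 'b set) \<Rightarrow> 'b multiset \<Rightarrow> nat \<Rightarrow> nat" where
  "counts m B \<gamma> = (\<lambda>j\<in>{..<m}. count_in (B j) \<gamma>)"

abbreviation count_vectors :: "nat \<Rightarrow> (nat \<Rightarrow> nat) set" where
  "count_vectors m \<equiv> PiE {..<m} (\<lambda>_. UNIV)"

lemma countable_count_vectors: "countable (count_vectors m)"
  by (rule countable_PiE) auto

lemma measurable_counts:
  assumes "partition_of M m B"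
  shows "counts m B \<in> measurable (config_space M) (count_space (count_vectors m))"
  unfolding measurable_count_space_eq_countable[OF countable_count_vectors]
proof (intro conjI ballI)
  fix k assume k: "k \<in> count_vectors m"
  have "counts m B -` {k} \<inter> space (config_space M)
      = {\<gamma> \<in> space (config_space M). \<forall>j\<in>{..<m}. count_in (B j) \<gamma> = k j}"
    using k by (auto simp: counts_def PiE_def extensional_def fun_eq_iff restrict_def)
  also have "\<dots> \<in> sets (config_space M)"
  proof (rule sets.sets_Collect_finite_All)
    fix j assume "j \<in> {..<m}"
    then have [measurable]: "B j \<in> sets M" using assms by (auto simp: partition_of_def)
    show "{\<gamma> \<in> space (config_space M). count_in (B j) \<gamma> = k j} \<in> sets (config_space M)"
      by measurable
  qed simp
  finally show "counts m B -` {k} \<inter> space (config_space M) \<in> sets (config_space M)" .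
qed (simp add: counts_def)

lemma counts_in: "counts m B \<gamma> \<in> count_vectors m"
  by (simp add: counts_def)

text \<open>The cells are the atoms of the set algebra generated by \<open>F\<close>: for each
  \<open>T \<subseteq> F\<close>, the points that lie in the members of \<open>T\<close> and in no
  other member of \<open>F\<close>.\<close>

lemma ex_partition_of:
  assumes F: "finite F" "F \<subseteq> sets M"
  obtains m B where "partition_of M m B" "\<And>A. A \<in> F \<Longrightarrow> \<exists>J\<subseteq>{..<m}. A = (\<Union>j\<in>J. B j)"
proof -
  define cell where "cell T = {x \<in> space M. \<forall>A\<in>F. x \<in> A \<longleftrightarrow> A \<in> T}" for T
  obtain h where h: "bij_betw h {..<card (Pow F)} (Pow F)"
    using ex_bij_betw_nat_finite[of "Pow F"] F(1) by (auto simp: atLeast0LessThan)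
  have cover: "x \<in> cell {A \<in> F. x \<in> A}" if "x \<in> space M" for x
    using that by (auto simp: cell_def)
  have reach: "\<exists>j<card (Pow F). h j = T" if "T \<subseteq> F" for T
  proof -
    have "T \<in> h ` {..<card (Pow F)}"
      using bij_betw_imp_surj_on[OF h] that by simp
    then show ?thesis by auto
  qed
  have "partition_of M (card (Pow F)) (cell \<circ> h)"
    unfolding partition_of_def
  proof (intro conjI allI impI)
    fix j
    have "{x \<in> space M. x \<in> A \<longleftrightarrow> A \<in> h j} \<in> sets M" if "A \<in> F" for A
    proof -
      have A: "A \<in> sets M" using that F(2) by auto
      then have "{x \<in> space M. x \<in> A \<longleftrightarrow> A \<in> h j} = (if A \<in> h j then A else space M - A)"
        using sets.sets_into_space by auto
      then show ?thesis using A by auto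
    qed
    then have "{x \<in> space M. \<forall>A\<in>F. x \<in> A \<longleftrightarrow> A \<in> h j} \<in> sets M"
      by (intro sets.sets_Collect_finite_All F(1))
    then show "(cell \<circ> h) j \<in> sets M"
      by (simp add: cell_def)
  next
    show "disjoint_family_on (cell \<circ> h) {..<card (Pow F)}"
    proof (unfold disjoint_family_on_def, intro ballI impI)
      fix i j assume ij: "i \<in> {..<card (Pow F)}" "j \<in> {..<card (Pow F)}" "i \<noteq> j"
      then have "h i \<noteq> h j" "h i \<subseteq> F" "h j \<subseteq> F"
        using h by (auto simp: bij_betw_def inj_on_def)
      then show "(cell \<circ> h) i \<inter> (cell \<circ> h) j = {}"
        by (auto simp: cell_def)
    qed
  next
    show "(\<Union>j<card (Pow F). (cell \<circ> h) j) = space M"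
    proof safe
      fix x assume "x \<in> space M"
      moreover obtain j where "j < card (Pow F)" "h j = {A \<in> F. x \<in> A}"
        using reach[of "{A \<in> F. x \<in> A}"] by auto
      ultimately show "x \<in> (\<Union>j<card (Pow F). (cell \<circ> h) j)"
        using cover by (auto intro!: bexI[of _ j])
    qed (auto simp: cell_def)
  qed
  moreover have "\<exists>J\<subseteq>{..<card (Pow F)}. A = (\<Union>j\<in>J. (cell \<circ> h) j)" if A: "A \<in> F" for A
  proof (intro exI[of _ "{j \<in> {..<card (Pow F)}. A \<in> h j}"] conjI equalityI subsetI)
    fix x assume "x \<in> A"
    then have "x \<in> space M" using A F(2) sets.sets_into_space by blast
    moreover obtain j where "j < card (Pow F)" "h j = {A \<in> F. x \<in> A}"
      using reach[of "{A \<in> F. x \<in> A}"] by auto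
    ultimately show "x \<in> (\<Union>j\<in>{j \<in> {..<card (Pow F)}. A \<in> h j}. (cell \<circ> h) j)"
      using cover A \<open>x \<in> A\<close> by (auto intro!: bexI[of _ j])
  qed (use A in \<open>auto simp: cell_def\<close>)
  ultimately show thesis by (rule that)
qed

text \<open>Counts add up over disjoint cells, so on a partition that resolves all sets of
  \<open>W\<close> the cylinder only constrains sums of entries of the count vector.\<close>

lemma count_event_counts:
  assumes B: "partition_of M m B"
    and W: "\<And>A. A \<in> fst ` W \<Longrightarrow> \<exists>J\<subseteq>{..<m}. A = (\<Union>j\<in>J. B j)"
  obtains Q where "\<And>\<gamma>. \<gamma> \<in> configurations M \<Longrightarrow> \<gamma> \<in> count_event M W \<longleftrightarrow> Q (counts m B \<gamma>)"
proof -
  obtain J where J: "\<And>A. A \<in> fst ` W \<Longrightarrow> J A \<subseteq> {..<m} \<and> A = (\<Union>j\<in>J A. B j)"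
    using W by metis
  have "count_in A \<gamma> = (\<Sum>j\<in>J A. counts m B \<gamma> j)" if A: "A \<in> fst ` W" for A \<gamma>
  proof -
    have "finite (J A)" "disjoint_family_on B (J A)"
      using J[OF A] B disjoint_family_on_mono[of "J A" "{..<m}" B]
      by (auto simp: partition_of_def intro: finite_subset)
    then have "count_in (\<Union>j\<in>J A. B j) \<gamma> = (\<Sum>j\<in>J A. count_in (B j) \<gamma>)"
      by (rule count_in_UN)
    also have "\<dots> = (\<Sum>j\<in>J A. counts m B \<gamma> j)"
      using J[OF A] by (intro sum.cong) (auto simp: counts_def)
    finally show ?thesis
      using J[OF A] by simp
  qed
  then have "\<gamma> \<in> count_event M W \<longleftrightarrow> (\<forall>(A, k)\<in>W. (\<Sum>j\<in>J A. counts m B \<gamma> j) = k)"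
    if "\<gamma> \<in> configurations M" for \<gamma>
    using that by (force simp: count_event_def)
  then show thesis
    by (rule that[of "\<lambda>c. \<forall>(A, k)\<in>W. (\<Sum>j\<in>J A. c j) = k"])
qed

lemma counts_remove:
  assumes B: "partition_of M m B" and "x \<in># \<gamma>" "j < m" "x \<in> B j"
  shows "counts m B (\<gamma> - {#x#}) = (counts m B \<gamma>)(j := counts m B \<gamma> j - 1)"
proof
  fix i
  obtain \<gamma>' where \<gamma>: "\<gamma> = add_mset x \<gamma>'"
    using assms(2) by (metis insert_DiffM)
  have "i < m \<Longrightarrow> x \<in> B i \<longleftrightarrow> i = j"
    using assms by (auto simp: partition_of_def disjoint_family_on_def)
  then show "counts m B (\<gamma> - {#x#}) i = ((counts m B \<gamma>)(j := counts m B \<gamma> j - 1)) i"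
    using assms(3) by (auto simp: counts_def \<gamma>)
qed

text \<open>All points of one cell contribute alike: there are \<open>counts m B \<gamma> j\<close>
  of them, and removing any one lowers entry \<open>j\<close> by one. For an empty cell the
  truncated subtraction is harmless, because the term has the factor 0.\<close>

lemma sum_mset_indicator_remove:
  fixes u :: "(nat \<Rightarrow> nat) \<Rightarrow> ennreal"
  assumes B: "partition_of M m B" and J: "J \<subseteq> {..<m}"
    and u: "\<And>\<gamma>. \<gamma> \<in> configurations M \<Longrightarrow> g \<gamma> = u (counts m B \<gamma>)"
    and \<gamma>: "\<gamma> \<in> configurations M"
  shows "(\<Sum>x\<in>#\<gamma>. indicator (\<Union>j\<in>J. B j) x * g (\<gamma> - {#x#}))
    = (\<Sum>j\<in>J. of_nat (counts m B \<gamma> j) * u ((counts m B \<gamma>)(j := counts m B \<gamma> j - 1)))"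
proof -
  define c where "c = counts m B \<gamma>"
  have fin: "finite J" using J by (rule finite_subset) simp
  have "indicator (\<Union>j\<in>J. B j) x * g (\<gamma> - {#x#})
      = (\<Sum>j\<in>J. indicator (B j) x * u (c(j := c j - 1)))" if x: "x \<in># \<gamma>" for x
  proof (cases "x \<in> (\<Union>j\<in>J. B j)")
    case True
    then obtain i where i: "i \<in> J" "x \<in> B i" by auto
    have "x \<in> B j \<longleftrightarrow> j = i" if "j \<in> J" for j
      using B J i that disjoint_family_onD[of B "{..<m}" i j] by (auto simp: partition_of_def)
    then have "(\<Sum>j\<in>J. indicator (B j) x * u (c(j := c j - 1)))
        = (\<Sum>j\<in>J. if j = i then u (c(i := c i - 1)) else 0)"
      by (intro sum.cong) (auto simp: indicator_def)
    also have "\<dots> = u (c(i := c i - 1))"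
      using i fin by simp
    also have "\<dots> = g (\<gamma> - {#x#})"
      using counts_remove[OF B x _ i(2)] i J \<gamma> by (auto simp: u configurations_diff c_def)
    finally show ?thesis using True by simp
  qed (auto simp: indicator_def)
  then have "(\<Sum>x\<in>#\<gamma>. indicator (\<Union>j\<in>J. B j) x * g (\<gamma> - {#x#}))
      = (\<Sum>x\<in>#\<gamma>. \<Sum>j\<in>J. indicator (B j) x * u (c(j := c j - 1)))"
    by (intro arg_cong[of _ _ sum_mset] image_mset_cong)
  also have "\<dots> = (\<Sum>j\<in>J. of_nat (count_in (B j) \<gamma>) * u (c(j := c j - 1)))"
    unfolding sum_mset_sum_swap by (simp add: sum_mset_indicator flip: sum_mset_distrib_right)
  also have "\<dots> = (\<Sum>j\<in>J. of_nat (c j) * u (c(j := c j - 1)))"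
    using J by (intro sum.cong) (auto simp: c_def counts_def)
  finally show ?thesis by (simp add: c_def)
qed

section \<open>Measurability of sums over a removed point\<close>

text \<open>A partition resolving \<open>a\<close> together with all sets of the cylinder
  \<open>b\<close> turns the sum into a function of \<open>counts\<close>, which takes countably
  many values.\<close>

lemma measurable_sum_remove_rectangle:
  assumes a: "a \<in> sets M" and b: "b \<in> count_events M"
  shows "(\<lambda>\<gamma>. \<Sum>x\<in>#\<gamma>. indicator a x * indicator b (\<gamma> - {#x#}) :: ennreal)
    \<in> borel_measurable (config_space M)"
proof -
  obtain W where W: "b = count_event M W" "finite W" "fst ` W \<subseteq> sets M"
    using b by (auto simp: count_events_def)
  obtain m B where B: "partition_of M m B"
    and cells: "\<And>A. A \<in> insert a (fst ` W) \<Longrightarrow> \<exists>J\<subseteq>{..<m}. A = (\<Union>j\<in>J. B j)"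
  proof -
    have "finite (insert a (fst ` W))" "insert a (fst ` W) \<subseteq> sets M" using W a by auto
    from ex_partition_of[OF this] that show thesis by metis
  qed
  obtain J where J: "J \<subseteq> {..<m}" "a = (\<Union>j\<in>J. B j)"
    using cells[of a] by auto
  obtain Q where Q: "\<And>\<gamma>. \<gamma> \<in> configurations M \<Longrightarrow> \<gamma> \<in> b \<longleftrightarrow> Q (counts m B \<gamma>)"
    using count_event_counts[OF B, of W] cells W(1) by auto
  define u :: "(nat \<Rightarrow> nat) \<Rightarrow> ennreal" where "u c = (if Q c then 1 else 0)" for c
  have "indicator b \<gamma> = u (counts m B \<gamma>)" if "\<gamma> \<in> configurations M" for \<gamma>
    using Q[OF that] by (simp add: u_def indicator_def)
  from sum_mset_indicator_remove[OF B J(1), of "indicator b" u, OF this]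
  have eq: "(\<Sum>x\<in>#\<gamma>. indicator a x * indicator b (\<gamma> - {#x#}))
      = (\<lambda>c. \<Sum>j\<in>J. of_nat (c j) * u (c(j := c j - 1))) (counts m B \<gamma>)"
    if "\<gamma> \<in> space (config_space M)" for \<gamma>
    using that J(2) by simp
  have "(\<lambda>\<gamma>. (\<lambda>c. \<Sum>j\<in>J. of_nat (c j) * u (c(j := c j - 1))) (counts m B \<gamma>))
      \<in> borel_measurable (config_space M)"
    by (rule measurable_compose[OF measurable_counts[OF B]]) simp
  then show ?thesis
    by (subst measurable_cong[where g = "\<lambda>\<gamma>. (\<lambda>c. \<Sum>j\<in>J. of_nat (c j) * u (c(j := c j - 1))) (counts m B \<gamma>)"])
      (rule eq)
qed

lemma sum_mset_config_cong:
  assumes "\<gamma> \<in> configurations M"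
    and "\<And>x. x \<in> space M \<Longrightarrow> x \<in># \<gamma> \<Longrightarrow> f x = g x"
  shows "(\<Sum>x\<in>#\<gamma>. f x) = (\<Sum>x\<in>#\<gamma>. g x)"
  using assms configurations_member[OF assms(1)]
  by (intro arg_cong[of _ _ sum_mset] image_mset_cong) auto

text \<open>The points of a multiset come without an enumeration, so the sum is not a composition of
  measurable maps. Instead a Dynkin argument starts from the rectangles
  \<open>a \<times> b \<times> c\<close> with \<open>b\<close> a cylinder, which form an
  intersection-stable generator of the triple product.\<close>

lemma measurable_sum_remove_sets:
  fixes M :: "'b measure" and N :: "'c measure"
  assumes "A \<in> sets (M \<Otimes>\<^sub>M (config_space M \<Otimes>\<^sub>M N))"
  shows "(\<lambda>(\<gamma>, y). \<Sum>x\<in>#\<gamma>. indicator A (x, \<gamma> - {#x#}, y) :: ennreal)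
    \<in> borel_measurable (config_space M \<Otimes>\<^sub>M N)"
proof -
  define E where "E = {b \<times> c | b c. b \<in> count_events M \<and> c \<in> sets N}"
  define G where "G = {a \<times> e | a e. a \<in> sets M \<and> e \<in> E}"
  let ?X = "space (config_space M \<Otimes>\<^sub>M N)" and ?Y = "space (M \<Otimes>\<^sub>M (config_space M \<Otimes>\<^sub>M N))"
  have E_Pow: "E \<subseteq> Pow ?X"
    using count_events_Pow[of M] sets.space_closed[of N] by (auto simp: E_def space_pair_measure)
  have "sets (config_space M \<Otimes>\<^sub>M N) = sets (sigma (space (config_space M) \<times> space N) E)"
    unfolding E_def
  proof (rule sets_pair_eq)
    show "sets (config_space M) = sigma_sets (space (config_space M)) (count_events M)"
      by (simp add: sets_config_space_count_events)
    show "sets N = sigma_sets (space N) (sets N)"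
      by (simp add: sets.sigma_sets_eq)
    show "{configurations M} \<subseteq> count_events M" "\<Union>{configurations M} = space (config_space M)"
      using configurations_count_events by auto
    show "{space N} \<subseteq> sets N" "\<Union>{space N} = space N" by auto
  qed (use count_events_Pow in \<open>auto dest: sets.sets_into_space\<close>)
  then have E: "sets (config_space M \<Otimes>\<^sub>M N) = sigma_sets ?X E"
    using E_Pow by (simp add: space_pair_measure)
  have G_Pow: "G \<subseteq> Pow ?Y"
    using E_Pow sets.space_closed[of M] by (auto simp: G_def space_pair_measure)
  have "sets (M \<Otimes>\<^sub>M (config_space M \<Otimes>\<^sub>M N)) = sets (sigma (space M \<times> ?X) G)"
    unfolding G_def
  proof (rule sets_pair_eq)
    show "sets M = sigma_sets (space M) (sets M)"
      by (simp add: sets.sigma_sets_eq)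
    have "?X = configurations M \<times> space N" by (simp add: space_pair_measure)
    then show "{?X} \<subseteq> E"
      unfolding E_def using configurations_count_events[of M] by blast
    show "{space M} \<subseteq> sets M" "\<Union>{space M} = space M" "\<Union>{?X} = ?X" by auto
  qed (use E E_Pow in \<open>auto dest: sets.sets_into_space\<close>)
  then have G: "sets (M \<Otimes>\<^sub>M (config_space M \<Otimes>\<^sub>M N)) = sigma_sets ?Y G"
    using G_Pow by (simp add: space_pair_measure)
  have "Int_stable E"
  proof (rule Int_stableI)
    fix p q assume "p \<in> E" "q \<in> E"
    then obtain b c b' c' where pq: "p = b \<times> c" "q = b' \<times> c'" "b \<in> count_events M" "b' \<in> count_events M"
      "c \<in> sets N" "c' \<in> sets N" by (auto simp: E_def)
    then have "p \<inter> q = (b \<inter> b') \<times> (c \<inter> c')" "b \<inter> b' \<in> count_events M" "c \<inter> c' \<in> sets N"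
      using Int_stable_count_events[of M] by (auto simp: Int_stable_def)
    then show "p \<inter> q \<in> E" unfolding E_def by blast
  qed
  have "Int_stable G"
  proof (rule Int_stableI)
    fix p q assume "p \<in> G" "q \<in> G"
    then obtain a e a' e' where pq: "p = a \<times> e" "q = a' \<times> e'" "e \<in> E" "e' \<in> E"
      "a \<in> sets M" "a' \<in> sets M" by (auto simp: G_def)
    then have "p \<inter> q = (a \<inter> a') \<times> (e \<inter> e')" "e \<inter> e' \<in> E" "a \<inter> a' \<in> sets M"
      using \<open>Int_stable E\<close> by (auto simp: Int_stable_def)
    then show "p \<inter> q \<in> G" unfolding G_def by blast
  qed
  from this G_Pow assms[unfolded G] show ?thesis
  proof (induction rule: sigma_sets_induct_disjoint)
    case (basic A)
    then obtain a b c where A: "A = a \<times> b \<times> c" "a \<in> sets M" "b \<in> count_events M"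
      and c[measurable]: "c \<in> sets N"
      by (auto simp: G_def E_def)
    have "indicator A (x, \<gamma>, y) = indicator a x * indicator b \<gamma> * (indicator c y :: ennreal)" for x \<gamma> y
      by (auto simp: A indicator_def)
    then have "(\<lambda>(\<gamma>, y). \<Sum>x\<in>#\<gamma>. indicator A (x, \<gamma> - {#x#}, y) :: ennreal)
        = (\<lambda>(\<gamma>, y). (\<Sum>x\<in>#\<gamma>. indicator a x * indicator b (\<gamma> - {#x#})) * indicator c y)"
      by (simp add: sum_mset_distrib_right)
    moreover note measurable_sum_remove_rectangle[OF A(2,3), measurable]
    ultimately show ?case by simp
  next
    case empty
    show ?case by simp
  next
    case (compl A)
    note compl.IH[measurable]
    \<comment> \<open>The sums for \<open>A\<close> and for its complement add up to
      \<open>size \<gamma>\<close>. This is finite, so the subtraction in \<open>ennreal\<close> is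
      exact.\<close>
    have "(\<Sum>x\<in>#\<gamma>. indicator (?Y - A) (x, \<gamma> - {#x#}, y) :: ennreal)
        = of_nat (size \<gamma>) - (\<Sum>x\<in>#\<gamma>. indicator A (x, \<gamma> - {#x#}, y))"
      if "(\<gamma>, y) \<in> ?X" for \<gamma> y
    proof -
      let ?s = "\<Sum>x\<in>#\<gamma>. indicator (?Y - A) (x, \<gamma> - {#x#}, y) :: ennreal"
      let ?t = "\<Sum>x\<in>#\<gamma>. indicator A (x, \<gamma> - {#x#}, y) :: ennreal"
      have "?s + ?t = (\<Sum>x\<in>#\<gamma>. 1)"
        unfolding sum_mset.distrib[symmetric]
      proof (rule sum_mset_config_cong)
        show "\<gamma> \<in> configurations M" using that by (simp add: space_pair_measure)
        fix x assume "x \<in> space M" "x \<in># \<gamma>"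
        then have "(x, \<gamma> - {#x#}, y) \<in> ?Y"
          using that by (simp add: space_pair_measure configurations_diff)
        then show "indicator (?Y - A) (x, \<gamma> - {#x#}, y) + indicator A (x, \<gamma> - {#x#}, y) = (1::ennreal)"
          by (simp add: indicator_def)
      qed
      then have st: "?s + ?t = of_nat (size \<gamma>)"
        by (simp only: sum_mset_const_mult mult_1_right)
      then have "?s + ?t \<noteq> \<top>"
        by (simp only: ennreal_of_nat_neq_top not_False_eq_True)
      then have "?t \<noteq> \<top>"
        by (simp only: ennreal_add_eq_top de_Morgan_disj simp_thms)
      then have "?s = ?s + ?t - ?t"
        by (rule ennreal_add_diff_cancel_right[symmetric])
      then show ?thesis
        by (simp only: st)
    qed
    moreover have "(\<lambda>(\<gamma>, y). of_nat (size \<gamma>) - (\<Sum>x\<in>#\<gamma>. indicator A (x, \<gamma> - {#x#}, y) :: ennreal))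
        \<in> borel_measurable (config_space M \<Otimes>\<^sub>M N)"
      by measurable
    ultimately show ?case
      by (subst measurable_cong[where g = "\<lambda>(\<gamma>, y).
        of_nat (size \<gamma>) - (\<Sum>x\<in>#\<gamma>. indicator A (x, \<gamma> - {#x#}, y) :: ennreal)"]) (auto split: prod.splits)
  next
    case (union A)
    have "indicator (\<Union>i. A i) z = (\<Sum>i. indicator (A i) z :: ennreal)" for z
      using suminf_indicator[OF union(1)] by metis
    then have "(\<lambda>(\<gamma>, y). \<Sum>x\<in>#\<gamma>. indicator (\<Union>i. A i) (x, \<gamma> - {#x#}, y) :: ennreal)
        = (\<lambda>(\<gamma>, y). \<Sum>i. \<Sum>x\<in>#\<gamma>. indicator (A i) (x, \<gamma> - {#x#}, y))"
      by (simp add: sum_mset_suminf_ennreal)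
    moreover note union.IH[measurable]
    ultimately show ?case by simp
  qed
qed

text \<open>The parameter \<open>y \<in> N\<close> is what makes the measure of a neighbourhood \<open>N(\<gamma>)\<close> accessible: it is the
  integral over \<open>y\<close> of the indicator of \<open>\<Sum>x\<in>#\<gamma>. G (x, y) \<noteq> 0\<close>.\<close>

theorem measurable_sum_remove:
  fixes G :: "'b \<times> 'b multiset \<times> 'c \<Rightarrow> ennreal"
  assumes "G \<in> borel_measurable (M \<Otimes>\<^sub>M (config_space M \<Otimes>\<^sub>M N))"
  shows "(\<lambda>(\<gamma>, y). \<Sum>x\<in>#\<gamma>. G (x, \<gamma> - {#x#}, y)) \<in> borel_measurable (config_space M \<Otimes>\<^sub>M N)"
  using assms
proof (induction rule: borel_measurable_induct)
  case (cong f g)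
  have "(\<Sum>x\<in>#\<gamma>. f (x, \<gamma> - {#x#}, y)) = (\<Sum>x\<in>#\<gamma>. g (x, \<gamma> - {#x#}, y))"
    if "(\<gamma>, y) \<in> space (config_space M \<Otimes>\<^sub>M N)" for \<gamma> y
    using that cong(3)
    by (intro sum_mset_config_cong[of _ M]) (auto simp: space_pair_measure configurations_diff)
  with cong(4) show ?case
    by (subst measurable_cong[of _ _ "\<lambda>(\<gamma>, y). \<Sum>x\<in>#\<gamma>. g (x, \<gamma> - {#x#}, y)"]) auto
next
  case (set A)
  then show ?case by (rule measurable_sum_remove_sets)
next
  case (mult u c)
  note mult.IH[measurable]
  have "(\<lambda>(\<gamma>, y). \<Sum>x\<in>#\<gamma>. c * u (x, \<gamma> - {#x#}, y)) = (\<lambda>(\<gamma>, y). c * (\<Sum>x\<in>#\<gamma>. u (x, \<gamma> - {#x#}, y)))"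
    by (simp add: sum_mset_distrib_left)
  then show ?case by simp
next
  case (add u v)
  note add.IH[measurable]
  show ?case by (simp add: sum_mset.distrib)
next
  case (seq U)
  note seq.IH[measurable]
  have "(\<lambda>(\<gamma>, y). \<Sum>x\<in>#\<gamma>. (SUP i. U i) (x, \<gamma> - {#x#}, y))
      = (\<lambda>(\<gamma>, y). SUP i. \<Sum>x\<in>#\<gamma>. U i (x, \<gamma> - {#x#}, y))"
    using \<open>incseq U\<close> by (auto simp: fun_eq_iff image_comp incseq_def le_fun_def intro!: sum_mset_SUP_ennreal)
  then show ?case by simp
qed

section \<open>The Mecke formula and splittings of Poisson configurations\<close>

locale finite_poisson = finite_measure M
  for M :: "'b measure" +
  fixes P :: "'b multiset measure"
  assumes poisson: "poisson_point_process M P"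
begin

sublocale P: prob_space P
  using poisson by (simp add: poisson_point_process_def)

sublocale PP: pair_sigma_finite P P ..
sublocale MP: pair_sigma_finite M P ..

lemma sets_P [measurable_cong]: "sets P = sets (config_space M)"
  using poisson by (simp add: poisson_point_process_def)

lemma space_P: "space P = configurations M"
  using sets_eq_imp_space_eq[OF sets_P] by simp

lemma prob_count_vector:
  assumes B: "partition_of M m B" and k: "k \<in> count_vectors m"
  shows "P.prob {\<gamma> \<in> configurations M. counts m B \<gamma> = k}
    = (\<Prod>j<m. exp (- measure M (B j)) * measure M (B j) ^ k j / fact (k j))"
\<comment> \<open>Without cells the intersection of the count events would be \<open>UNIV\<close>
  instead of \<open>space P\<close>, so this case is separate.\<close>
proof (cases "m = 0")
  case True
  then have "{\<gamma> \<in> configurations M. counts m B \<gamma> = k} = space P"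
    using k by (auto simp: counts_def space_P)
  then show ?thesis
    using True P.prob_space by simp
next
  case False
  have "{\<gamma> \<in> configurations M. counts m B \<gamma> = k}
      = (\<Inter>j\<in>{..<m}. count_in (B j) -` {k j} \<inter> space P)"
    using k False
    by (auto simp: counts_def space_P PiE_def extensional_def fun_eq_iff restrict_def)
  moreover have "\<forall>(I :: nat set) A. finite I \<and> A ` I \<subseteq> sets M \<and> disjoint_family_on A I \<longrightarrow>
      P.indep_vars (\<lambda>_. count_space UNIV) (\<lambda>i. count_in (A i)) I"
    using poisson by (simp add: poisson_point_process_def)
  then have "P.indep_vars (\<lambda>_. count_space UNIV) (\<lambda>j. count_in (B j)) {..<m}"
    by (rule allE[of _ "{..<m}"], elim allE[of _ B] impE) (use B in \<open>auto simp: partition_of_def\<close>)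
  then have "P.prob (\<Inter>j\<in>{..<m}. count_in (B j) -` {k j} \<inter> space P)
      = (\<Prod>j<m. P.prob (count_in (B j) -` {k j} \<inter> space P))"
    by (rule P.indep_varsD_finite) (use False in auto)
  moreover have "P.prob (count_in (B j) -` {k j} \<inter> space P)
      = exp (- measure M (B j)) * measure M (B j) ^ k j / fact (k j)" if "j < m" for j
  proof -
    have "count_in (B j) -` {k j} \<inter> space P = {\<gamma> \<in> space P. count_in (B j) \<gamma> = k j}"
      by auto
    then show ?thesis
      using poisson B that by (simp add: poisson_point_process_def partition_of_def)
  qed
  ultimately show ?thesis by simp
qed

lemma sets_count_vector:
  assumes "partition_of M m B"
  shows "{\<gamma> \<in> configurations M. counts m B \<gamma> = k} \<in> sets (config_space M)"
proof (cases "k \<in> count_vectors m")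
  case True
  then show ?thesis
    using measurable_sets[OF measurable_counts[OF assms], of "{k}"]
    by (simp add: vimage_def Int_def conj_commute)
next
  case False
  then have "{\<gamma> \<in> configurations M. counts m B \<gamma> = k} = {}"
    using counts_in[of m B] by auto
  then show ?thesis by (simp only: sets.empty_sets)
qed

lemma size_counts:
  assumes B: "partition_of M m B" and "\<gamma> \<in> configurations M"
  shows "size \<gamma> = (\<Sum>j<m. counts m B \<gamma> j)"
proof -
  have "size \<gamma> = count_in (\<Union>j<m. B j) \<gamma>"
    using assms by (simp add: partition_of_def count_in_space)
  also have "\<dots> = (\<Sum>j<m. count_in (B j) \<gamma>)"
    using B by (intro count_in_UN) (auto simp: partition_of_def)
  finally show ?thesis by (simp add: counts_def)
qed

text \<open>For one cell this is
  \<open>t * (t ^ (k - 1) / fact (k - 1)) = k * (t ^ k / fact k)\<close>; by independence the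
  factors of the other cells are unchanged. For \<open>k j = 0\<close> both sides vanish.\<close>

lemma prob_count_vector_remove:
  assumes B: "partition_of M m B" and k: "k \<in> count_vectors m" and j: "j < m"
  shows "measure M (B j) * (if k j = 0 then 0
      else P.prob {\<gamma> \<in> configurations M. counts m B \<gamma> = k(j := k j - 1)})
    = real (k j) * P.prob {\<gamma> \<in> configurations M. counts m B \<gamma> = k}"
proof (cases "k j")
  case (Suc n)
  define p where "p l i = exp (- measure M (B i)) * measure M (B i) ^ l i / fact (l i)" for l i
  have k': "k(j := n) \<in> count_vectors m"
    using k j by (auto simp: PiE_def extensional_def)
  have "(\<Prod>i\<in>{..<m} - {j}. p (k(j := n)) i) = (\<Prod>i\<in>{..<m} - {j}. p k i)"
    by (intro prod.cong) (auto simp: p_def)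
  moreover have "measure M (B j) * p (k(j := n)) j = real (k j) * p k j"
    using Suc by (simp add: p_def field_simps del: of_nat_Suc)
  ultimately have "measure M (B j) * (\<Prod>i<m. p (k(j := n)) i) = real (k j) * (\<Prod>i<m. p k i)"
    using j by (simp add: prod.remove[of "{..<m}" j])
  then show ?thesis
    using Suc by (simp add: prob_count_vector[OF B k] prob_count_vector[OF B k'] p_def)
qed simp

lemma counts_add_mset:
  assumes B: "partition_of M m B" and k: "k \<in> count_vectors m" and j: "j < m" "x \<in> B j"
  shows "counts m B (add_mset x \<gamma>) = k \<longleftrightarrow> k j \<noteq> 0 \<and> counts m B \<gamma> = k(j := k j - 1)"
proof -
  have "x \<in> B i \<longleftrightarrow> i = j" if "i < m" for i
    using B j that disjoint_family_onD[of B "{..<m}" i j] by (auto simp: partition_of_def)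
  then have "counts m B (add_mset x \<gamma>) = (counts m B \<gamma>)(j := Suc (counts m B \<gamma> j))"
    using j by (auto simp: counts_def fun_eq_iff)
  then show ?thesis
    by (cases "k j") (auto simp: fun_eq_iff)
qed

text \<open>If the added point falls into cell \<open>j\<close>, the rest must have the count vector
  \<open>k\<close> lowered at \<open>j\<close>. Integrating over the point gives the sum over
  \<open>j\<close> of \<open>measure M (B j)\<close> times that probability. By
  \<open>prob_count_vector_remove\<close> this is the sum of the \<open>k j\<close>, which is the
  size on \<open>E\<close>, times the probability of \<open>E\<close>.\<close>

lemma emeasure_mecke_count_vector:
  assumes B: "partition_of M m B" and k: "k \<in> count_vectors m"
  defines "E \<equiv> {\<gamma> \<in> configurations M. counts m B \<gamma> = k}"
  shows "emeasure (distr (M \<Otimes>\<^sub>M P) (config_space M) (\<lambda>(x, \<gamma>). add_mset x \<gamma>)) E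
    = emeasure (density P (\<lambda>\<gamma>. of_nat (size \<gamma>))) E"
proof -
  have E[measurable]: "E \<in> sets (config_space M)"
    unfolding E_def by (rule sets_count_vector[OF B])
  define c where "c j = (if k j = 0 then 0
      else P.prob {\<gamma> \<in> configurations M. counts m B \<gamma> = k(j := k j - 1)})" for j
  have c: "0 \<le> c j" for j by (simp add: c_def)
  have "emeasure (distr (M \<Otimes>\<^sub>M P) (config_space M) (\<lambda>(x, \<gamma>). add_mset x \<gamma>)) E
      = emeasure (M \<Otimes>\<^sub>M P) ((\<lambda>(x, \<gamma>). add_mset x \<gamma>) -` E \<inter> space (M \<Otimes>\<^sub>M P))"
    by (rule emeasure_distr) measurable
  also have "\<dots> = (\<integral>\<^sup>+x. emeasure P (Pair x -` ((\<lambda>(x, \<gamma>). add_mset x \<gamma>) -` E \<inter> space (M \<Otimes>\<^sub>M P))) \<partial>M)"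
    by (rule P.emeasure_pair_measure_alt) measurable
  also have "\<dots> = (\<integral>\<^sup>+x. (\<Sum>j<m. ennreal (c j) * indicator (B j) x) \<partial>M)"
  proof (rule nn_integral_cong)
    fix x assume x: "x \<in> space M"
    then obtain j where j: "j < m" "x \<in> B j"
      using B by (auto simp: partition_of_def)
    have "x \<in> B i \<longleftrightarrow> i = j" if "i < m" for i
      using B j that disjoint_family_onD[of B "{..<m}" i j] by (auto simp: partition_of_def)
    then have "(\<Sum>i<m. ennreal (c i) * indicator (B i) x) = (\<Sum>i<m. if i = j then ennreal (c j) else 0)"
      by (intro sum.cong) (auto simp: indicator_def)
    also have "\<dots> = ennreal (c j)" using j by simp
    also have "Pair x -` ((\<lambda>(x, \<gamma>). add_mset x \<gamma>) -` E \<inter> space (M \<Otimes>\<^sub>M P))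
        = (if k j = 0 then {} else {\<gamma> \<in> configurations M. counts m B \<gamma> = k(j := k j - 1)})"
      using x counts_add_mset[OF B k j] by (auto simp: E_def space_pair_measure space_P)
    then have "ennreal (c j) = emeasure P (Pair x -` ((\<lambda>(x, \<gamma>). add_mset x \<gamma>) -` E \<inter> space (M \<Otimes>\<^sub>M P)))"
      by (simp add: c_def P.emeasure_eq_measure)
    finally show "emeasure P (Pair x -` ((\<lambda>(x, \<gamma>). add_mset x \<gamma>) -` E \<inter> space (M \<Otimes>\<^sub>M P)))
        = (\<Sum>j<m. ennreal (c j) * indicator (B j) x)" by simp
  qed
  also have "\<dots> = (\<Sum>j<m. ennreal (c j) * emeasure M (B j))"
    using B by (subst nn_integral_sum) (auto simp: nn_integral_cmult_indicator partition_of_def)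
  also have "\<dots> = (\<Sum>j<m. ennreal (real (k j) * P.prob E))"
    using prob_count_vector_remove[OF B k] c
    by (intro sum.cong) (auto simp: emeasure_eq_measure c_def E_def mult.commute simp flip: ennreal_mult)
  also have "\<dots> = of_nat (\<Sum>j<m. k j) * emeasure P E"
    by (simp add: P.emeasure_eq_measure ennreal_mult sum_distrib_right flip: ennreal_of_nat_eq_real_of_nat)
  also have "\<dots> = (\<integral>\<^sup>+\<gamma>. of_nat (\<Sum>j<m. k j) * indicator E \<gamma> \<partial>P)"
    by (simp add: nn_integral_cmult_indicator)
  also have "\<dots> = (\<integral>\<^sup>+\<gamma>. of_nat (size \<gamma>) * indicator E \<gamma> \<partial>P)"
    by (intro nn_integral_cong) (auto simp: E_def indicator_def size_counts[OF B])
  also have "\<dots> = emeasure (density P (\<lambda>\<gamma>. of_nat (size \<gamma>))) E"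
    by (rule emeasure_density[symmetric]) measurable
  finally show ?thesis .
qed

text \<open>The Mecke formula as an identity of measures: adding a point with intensity
  \<open>M\<close> amounts to biasing by size. It suffices to compare cylinders, and each cylinder
  is a countable disjoint union of the count-vector atoms treated above.\<close>

lemma mecke:
  "distr (M \<Otimes>\<^sub>M P) (config_space M) (\<lambda>(x, \<gamma>). add_mset x \<gamma>) = density P (\<lambda>\<gamma>. of_nat (size \<gamma>))"
  (is "?L = ?R")
proof (rule measure_eqI_generator_eq[OF Int_stable_count_events count_events_Pow])
  fix X assume "X \<in> count_events M"
  then obtain W where W: "X = count_event M W" "finite W" "fst ` W \<subseteq> sets M"
    by (auto simp: count_events_def)
  obtain m B where B: "partition_of M m B"
    and cells: "\<And>A. A \<in> fst ` W \<Longrightarrow> \<exists>J\<subseteq>{..<m}. A = (\<Union>j\<in>J. B j)"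
  proof -
    have "finite (fst ` W)" using W by auto
    from ex_partition_of[OF this W(3)] that show thesis by metis
  qed
  obtain Q where Q: "\<And>\<gamma>. \<gamma> \<in> configurations M \<Longrightarrow> \<gamma> \<in> X \<longleftrightarrow> Q (counts m B \<gamma>)"
    using count_event_counts[OF B cells] W(1) by auto
  define E where "E k = {\<gamma> \<in> configurations M. counts m B \<gamma> = k}" for k
  have "X \<subseteq> configurations M"
    unfolding W(1) count_event_def by blast
  then have X: "X = (\<Union>k\<in>{k \<in> count_vectors m. Q k}. E k)"
    using Q counts_in[of m B] by (auto simp: E_def)
  have [measurable]: "E k \<in> sets (config_space M)" for k
    unfolding E_def by (rule sets_count_vector[OF B])
  have "countable {k \<in> count_vectors m. Q k}"
    by (rule countable_subset[OF _ countable_count_vectors[of m]]) auto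
  moreover have "disjoint_family_on E {k \<in> count_vectors m. Q k}"
    by (auto simp: disjoint_family_on_def E_def)
  ultimately have "emeasure \<rho> X = (\<integral>\<^sup>+k. emeasure \<rho> (E k) \<partial>count_space {k \<in> count_vectors m. Q k})"
    if "sets \<rho> = sets (config_space M)" for \<rho>
    unfolding X using that by (intro emeasure_UN_countable) auto
  note * = this
  show "emeasure ?L X = emeasure ?R X"
    by (subst (1 2) *) (auto simp: sets_P E_def emeasure_mecke_count_vector[OF B] intro!: nn_integral_cong)
next
  show "sets ?L = sigma_sets (configurations M) (count_events M)"
    "sets ?R = sigma_sets (configurations M) (count_events M)"
    by (simp_all add: sets_P sets_config_space_count_events)
  show "range (\<lambda>_::nat. configurations M) \<subseteq> count_events M"
    using configurations_count_events by auto
  show "emeasure ?L (configurations M) \<noteq> \<infinity>" for i :: nat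
  proof -
    have "emeasure ?L (configurations M) \<le> emeasure (M \<Otimes>\<^sub>M P) (space (M \<Otimes>\<^sub>M P))"
      by (subst emeasure_distr) (auto intro!: emeasure_mono simp: sets.top[of "config_space M", simplified])
    also have "\<dots> = emeasure M (space M) * emeasure P (space P)"
      unfolding space_pair_measure by (rule P.emeasure_pair_measure_Times) auto
    finally show ?thesis
      by (auto simp: P.emeasure_space_1 top_unique)
  qed
qed simp

lemma nn_integral_mecke:
  assumes [measurable]: "g \<in> borel_measurable (config_space M)"
  shows "(\<integral>\<^sup>+\<gamma>. of_nat (size \<gamma>) * g \<gamma> \<partial>P) = (\<integral>\<^sup>+x. \<integral>\<^sup>+\<gamma>. g (add_mset x \<gamma>) \<partial>P \<partial>M)"
proof -
  have "(\<integral>\<^sup>+\<gamma>. of_nat (size \<gamma>) * g \<gamma> \<partial>P) = (\<integral>\<^sup>+\<gamma>. g \<gamma> \<partial>density P (\<lambda>\<gamma>. of_nat (size \<gamma>)))"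
    by (rule nn_integral_density[symmetric]) measurable
  also have "\<dots> = (\<integral>\<^sup>+z. g (case z of (x, \<gamma>) \<Rightarrow> add_mset x \<gamma>) \<partial>(M \<Otimes>\<^sub>M P))"
    unfolding mecke[symmetric] by (rule nn_integral_distr) measurable
  also have "\<dots> = (\<integral>\<^sup>+x. \<integral>\<^sup>+\<gamma>. g (add_mset x \<gamma>) \<partial>P \<partial>M)"
    by (subst P.nn_integral_fst[symmetric]) (auto simp: case_prod_beta)
  finally show ?thesis .
qed

end

section \<open>Splittings of labelled points and pairs of independent copies\<close>

text \<open>Summing over index sets rather than submultisets keeps coinciding points apart: up to
  the factor \<open>2 ^ n\<close> this is the expectation when a fair coin assigns each point to a
  copy.\<close>

definition split_sum :: "nat \<Rightarrow> ('b multiset \<times> 'b multiset \<Rightarrow> 'c) \<Rightarrow> (nat \<Rightarrow> 'b) \<Rightarrow> 'c::comm_monoid_add" where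
  "split_sum n h p = (\<Sum>S\<in>Pow {..<n}.
     h (image_mset p (mset_set S), image_mset p (mset_set ({..<n} - S))))"

lemma split_sum_0: "split_sum 0 h p = h ({#}, {#})"
  by (simp add: split_sum_def)

text \<open>The last point joins either half. The resulting operation on \<open>h\<close> is the one
  that the Mecke formula for pairs produces below.\<close>

lemma split_sum_Suc:
  "split_sum (Suc n) h (p(n := x))
    = split_sum n (\<lambda>(a, b). h (add_mset x a, b) + h (a, add_mset x b)) p"
proof -
  let ?q = "p(n := x)"
  have q: "image_mset ?q (mset_set S) = image_mset p (mset_set S)" if "S \<subseteq> {..<n}" for S
  proof -
    have "finite S" "n \<notin> S" using that by (auto dest: finite_subset)
    then show ?thesis by (intro image_mset_cong) auto
  qed
  have "h (image_mset ?q (mset_set S), image_mset ?q (mset_set (insert n {..<n} - S)))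
      + h (image_mset ?q (mset_set (insert n S)), image_mset ?q (mset_set (insert n {..<n} - insert n S)))
    = h (image_mset p (mset_set S), add_mset x (image_mset p (mset_set ({..<n} - S))))
      + h (add_mset x (image_mset p (mset_set S)), image_mset p (mset_set ({..<n} - S)))"
    if S: "S \<in> Pow {..<n}" for S
  proof -
    have "n \<notin> S" "finite S" using S by (auto dest: finite_subset)
    moreover have "insert n {..<n} - S = insert n ({..<n} - S)"
      "insert n {..<n} - insert n S = {..<n} - S" using \<open>n \<notin> S\<close> by auto
    moreover have "{..<n} - S \<subseteq> {..<n}" by auto
    ultimately show ?thesis
      using S by (simp add: q)
  qed
  then show ?thesis
    unfolding split_sum_def lessThan_Suc
    by (subst sum_Pow_insert) (auto simp: add.commute intro!: sum.cong)
qed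

lemma measurable_indicator_size:
  "(\<lambda>z. indicator {n} (size (fst z) + size (snd z)) :: ennreal)
    \<in> borel_measurable (config_space M \<Otimes>\<^sub>M config_space M)"
proof -
  have [measurable]: "(\<lambda>z. size (fst z)) \<in> measurable (config_space M \<Otimes>\<^sub>M config_space M) (count_space UNIV)"
    "(\<lambda>z. size (snd z)) \<in> measurable (config_space M \<Otimes>\<^sub>M config_space M) (count_space UNIV)"
    by (rule measurable_compose[OF measurable_fst measurable_size_config],
        rule measurable_compose[OF measurable_snd measurable_size_config])
  have "(\<lambda>z. size (fst z) + size (snd z))
      \<in> measurable (config_space M \<Otimes>\<^sub>M config_space M) (count_space UNIV)"
    by measurable
  then show ?thesis
    by (rule measurable_compose) simp
qed

context finite_poisson
begin

text \<open>The Mecke formula in each copy separately, with Fubini moving the added point outermost.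
  The factor \<open>size a + size b\<close> is what lets the two identities be added.\<close>

lemma nn_integral_mecke_pair:
  fixes h :: "'b multiset \<times> 'b multiset \<Rightarrow> ennreal"
  assumes h[measurable]: "h \<in> borel_measurable (config_space M \<Otimes>\<^sub>M config_space M)"
  shows "(\<integral>\<^sup>+a. \<integral>\<^sup>+b. of_nat (size a + size b) * h (a, b) \<partial>P \<partial>P)
    = (\<integral>\<^sup>+x. \<integral>\<^sup>+a. \<integral>\<^sup>+b. h (add_mset x a, b) + h (a, add_mset x b) \<partial>P \<partial>P \<partial>M)"
proof -
  have "(\<integral>\<^sup>+a. \<integral>\<^sup>+b. of_nat (size a) * h (a, b) \<partial>P \<partial>P)
      = (\<integral>\<^sup>+a. of_nat (size a) * (\<integral>\<^sup>+b. h (a, b) \<partial>P) \<partial>P)"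
    by (intro nn_integral_cong nn_integral_cmult) (simp add: space_P)
  also have "\<dots> = (\<integral>\<^sup>+x. \<integral>\<^sup>+a. \<integral>\<^sup>+b. h (add_mset x a, b) \<partial>P \<partial>P \<partial>M)"
    by (rule nn_integral_mecke) measurable
  finally have 1: "(\<integral>\<^sup>+a. \<integral>\<^sup>+b. of_nat (size a) * h (a, b) \<partial>P \<partial>P)
      = (\<integral>\<^sup>+x. \<integral>\<^sup>+a. \<integral>\<^sup>+b. h (add_mset x a, b) \<partial>P \<partial>P \<partial>M)" .
  have "(\<integral>\<^sup>+a. \<integral>\<^sup>+b. of_nat (size b) * h (a, b) \<partial>P \<partial>P)
      = (\<integral>\<^sup>+a. \<integral>\<^sup>+x. \<integral>\<^sup>+b. h (a, add_mset x b) \<partial>P \<partial>M \<partial>P)"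
    by (intro nn_integral_cong nn_integral_mecke) (simp add: space_P)
  also have "\<dots> = (\<integral>\<^sup>+x. \<integral>\<^sup>+a. \<integral>\<^sup>+b. h (a, add_mset x b) \<partial>P \<partial>P \<partial>M)"
    by (rule MP.Fubini') measurable
  finally have 2: "(\<integral>\<^sup>+a. \<integral>\<^sup>+b. of_nat (size b) * h (a, b) \<partial>P \<partial>P)
      = (\<integral>\<^sup>+x. \<integral>\<^sup>+a. \<integral>\<^sup>+b. h (a, add_mset x b) \<partial>P \<partial>P \<partial>M)" .
  have "(\<integral>\<^sup>+a. \<integral>\<^sup>+b. of_nat (size a + size b) * h (a, b) \<partial>P \<partial>P)
      = (\<integral>\<^sup>+a. \<integral>\<^sup>+b. of_nat (size a) * h (a, b) \<partial>P \<partial>P)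
        + (\<integral>\<^sup>+a. \<integral>\<^sup>+b. of_nat (size b) * h (a, b) \<partial>P \<partial>P)"
    by (subst nn_integral_add[symmetric], measurable)
      (auto intro!: nn_integral_cong simp: space_P distrib_right nn_integral_add[symmetric])
  also have "\<dots> = (\<integral>\<^sup>+x. (\<integral>\<^sup>+a. \<integral>\<^sup>+b. h (add_mset x a, b) \<partial>P \<partial>P)
      + (\<integral>\<^sup>+a. \<integral>\<^sup>+b. h (a, add_mset x b) \<partial>P \<partial>P) \<partial>M)"
    unfolding 1 2 by (rule nn_integral_add[symmetric]) measurable
  also have "\<dots> = (\<integral>\<^sup>+x. \<integral>\<^sup>+a. \<integral>\<^sup>+b. h (add_mset x a, b) + h (a, add_mset x b) \<partial>P \<partial>P \<partial>M)"
    by (intro nn_integral_cong, subst nn_integral_add[symmetric], simp_all)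
      (auto intro!: nn_integral_cong simp: space_P nn_integral_add[symmetric])
  finally show ?thesis .
qed

text \<open>Given the superposition of two independent copies of the process, each of its points belongs to
  either copy with probability $1/2$ independently. Hence an inequality that holds after summation over
  all splittings of every fixed configuration holds in expectation.\<close>

lemma split_comparison_size:
  fixes h1 h2 :: "'b multiset \<times> 'b multiset \<Rightarrow> ennreal"
  assumes [measurable]: "h1 \<in> borel_measurable (config_space M \<Otimes>\<^sub>M config_space M)"
    "h2 \<in> borel_measurable (config_space M \<Otimes>\<^sub>M config_space M)"
    and "\<And>p. p ` {..<n} \<subseteq> space M \<Longrightarrow> split_sum n h1 p \<le> split_sum n h2 p"
  shows "(\<integral>\<^sup>+a. \<integral>\<^sup>+b. h1 (a, b) * indicator {n} (size a + size b) \<partial>P \<partial>P)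
    \<le> (\<integral>\<^sup>+a. \<integral>\<^sup>+b. h2 (a, b) * indicator {n} (size a + size b) \<partial>P \<partial>P)"
  using assms
proof (induction n arbitrary: h1 h2)
  case 0
  have "h1 ({#}, {#}) \<le> h2 ({#}, {#})"
    using 0(3)[of undefined] by (simp add: split_sum_0)
  then show ?case
    by (intro nn_integral_mono) (auto simp: indicator_def)
next
  case (Suc n)
  note Suc.prems(1,2)[measurable]
  define H where "H h x = (\<lambda>(a, b). h (add_mset x a, b) + h (a, add_mset x b))"
    for h :: "'b multiset \<times> 'b multiset \<Rightarrow> ennreal" and x
  \<comment> \<open>On the event in question \<open>Suc n\<close> equals
    \<open>size a + size b\<close>, so the Mecke formula trades this factor for one extra point and
    lowers the total size by one.\<close>
  have rec: "of_nat (Suc n) * (\<integral>\<^sup>+a. \<integral>\<^sup>+b. h (a, b) * indicator {Suc n} (size a + size b) \<partial>P \<partial>P)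
      = (\<integral>\<^sup>+x. \<integral>\<^sup>+a. \<integral>\<^sup>+b. H h x (a, b) * indicator {n} (size a + size b) \<partial>P \<partial>P \<partial>M)"
    if [measurable]: "h \<in> borel_measurable (config_space M \<Otimes>\<^sub>M config_space M)" for h
  proof -
    define u where "u z = h z * indicator {Suc n} (size (fst z) + size (snd z))" for z
    have [measurable]: "u \<in> borel_measurable (config_space M \<Otimes>\<^sub>M config_space M)"
      unfolding u_def by (intro borel_measurable_times_ennreal measurable_indicator_size that)
    have "of_nat (Suc n) * (\<integral>\<^sup>+a. \<integral>\<^sup>+b. u (a, b) \<partial>P \<partial>P)
        = (\<integral>\<^sup>+a. of_nat (Suc n) * (\<integral>\<^sup>+b. u (a, b) \<partial>P) \<partial>P)"
      by (rule nn_integral_cmult[symmetric]) measurable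
    also have "\<dots> = (\<integral>\<^sup>+a. \<integral>\<^sup>+b. of_nat (Suc n) * u (a, b) \<partial>P \<partial>P)"
      by (intro nn_integral_cong nn_integral_cmult[symmetric]) (simp add: space_P)
    also have "\<dots> = (\<integral>\<^sup>+a. \<integral>\<^sup>+b. of_nat (size a + size b) * u (a, b) \<partial>P \<partial>P)"
      by (intro nn_integral_cong) (auto simp: u_def indicator_def simp del: of_nat_add of_nat_Suc)
    also have "\<dots> = (\<integral>\<^sup>+x. \<integral>\<^sup>+a. \<integral>\<^sup>+b. H h x (a, b) * indicator {n} (size a + size b) \<partial>P \<partial>P \<partial>M)"
      by (subst nn_integral_mecke_pair, measurable)
        (auto intro!: nn_integral_cong simp: u_def H_def indicator_def)
    finally have "of_nat (Suc n) * (\<integral>\<^sup>+a. \<integral>\<^sup>+b. u (a, b) \<partial>P \<partial>P)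
        = (\<integral>\<^sup>+x. \<integral>\<^sup>+a. \<integral>\<^sup>+b. H h x (a, b) * indicator {n} (size a + size b) \<partial>P \<partial>P \<partial>M)" .
    then show ?thesis by (simp only: u_def fst_conv snd_conv)
  qed
  have "(\<integral>\<^sup>+x. \<integral>\<^sup>+a. \<integral>\<^sup>+b. H h1 x (a, b) * indicator {n} (size a + size b) \<partial>P \<partial>P \<partial>M)
      \<le> (\<integral>\<^sup>+x. \<integral>\<^sup>+a. \<integral>\<^sup>+b. H h2 x (a, b) * indicator {n} (size a + size b) \<partial>P \<partial>P \<partial>M)"
  proof (rule nn_integral_mono, rule Suc.IH)
    fix x assume x[measurable]: "x \<in> space M"
    show "H h1 x \<in> borel_measurable (config_space M \<Otimes>\<^sub>M config_space M)"
      "H h2 x \<in> borel_measurable (config_space M \<Otimes>\<^sub>M config_space M)"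
      unfolding H_def by measurable
    fix p :: "nat \<Rightarrow> 'b" assume "p ` {..<n} \<subseteq> space M"
    \<comment> \<open>With \<open>x\<close> as the last of \<open>n + 1\<close> labelled points, the
      hypothesis on \<open>h1\<close> and \<open>h2\<close> becomes the hypothesis on
      \<open>H h1 x\<close> and \<open>H h2 x\<close> for \<open>n\<close> points.\<close>
    then have "(p(n := x)) ` {..<Suc n} \<subseteq> space M"
      using x by (auto simp: less_Suc_eq)
    from Suc.prems(3)[OF this] show "split_sum n (H h1 x) p \<le> split_sum n (H h2 x) p"
      unfolding split_sum_Suc H_def .
  qed
  then have "of_nat (Suc n) * (\<integral>\<^sup>+a. \<integral>\<^sup>+b. h1 (a, b) * indicator {Suc n} (size a + size b) \<partial>P \<partial>P)
      \<le> of_nat (Suc n) * (\<integral>\<^sup>+a. \<integral>\<^sup>+b. h2 (a, b) * indicator {Suc n} (size a + size b) \<partial>P \<partial>P)"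
    unfolding rec[OF Suc.prems(1)] rec[OF Suc.prems(2)] .
  then show ?case
    by (subst (asm) ennreal_mult_le_mult_iff) auto
qed

text \<open>Every pair of configurations has a finite total size, so the integrals are countable
  sums over that size and can be compared term by term.\<close>

theorem split_comparison:
  fixes h1 h2 :: "'b multiset \<times> 'b multiset \<Rightarrow> ennreal"
  assumes [measurable]: "h1 \<in> borel_measurable (config_space M \<Otimes>\<^sub>M config_space M)"
    "h2 \<in> borel_measurable (config_space M \<Otimes>\<^sub>M config_space M)"
    and le: "\<And>n p. p ` {..<n} \<subseteq> space M \<Longrightarrow> split_sum n h1 p \<le> split_sum n h2 p"
  shows "integral\<^sup>N (P \<Otimes>\<^sub>M P) h1 \<le> integral\<^sup>N (P \<Otimes>\<^sub>M P) h2"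
proof -
  have decomp: "integral\<^sup>N (P \<Otimes>\<^sub>M P) h
      = (\<Sum>n. \<integral>\<^sup>+a. \<integral>\<^sup>+b. h (a, b) * indicator {n} (size a + size b) \<partial>P \<partial>P)"
    if [measurable]: "h \<in> borel_measurable (config_space M \<Otimes>\<^sub>M config_space M)" for h
  proof -
    have [measurable]: "(\<lambda>z. indicator {n} (size (fst z) + size (snd z)) :: ennreal)
        \<in> borel_measurable (config_space M \<Otimes>\<^sub>M config_space M)" for n
      by (rule measurable_indicator_size)
    have "h z = (\<Sum>n. h z * indicator {n} (size (fst z) + size (snd z)))" for z
    proof -
      have "(\<Sum>n. h z * indicator {n} (size (fst z) + size (snd z)))
          = (\<Sum>n\<in>{size (fst z) + size (snd z)}. h z * indicator {n} (size (fst z) + size (snd z)))"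
        by (rule suminf_finite) (auto simp: indicator_def)
      then show ?thesis by simp
    qed
    then have "integral\<^sup>N (P \<Otimes>\<^sub>M P) h
        = (\<integral>\<^sup>+z. (\<Sum>n. h z * indicator {n} (size (fst z) + size (snd z))) \<partial>(P \<Otimes>\<^sub>M P))"
      by (intro nn_integral_cong)
    also have "\<dots> = (\<Sum>n. \<integral>\<^sup>+z. h z * indicator {n} (size (fst z) + size (snd z)) \<partial>(P \<Otimes>\<^sub>M P))"
      by (rule nn_integral_suminf) measurable
    also have "\<dots> = (\<Sum>n. \<integral>\<^sup>+a. \<integral>\<^sup>+b. h (a, b) * indicator {n} (size a + size b) \<partial>P \<partial>P)"
      by (subst P.nn_integral_fst[symmetric]) auto
    finally show ?thesis .
  qed
  show ?thesis
    unfolding decomp[OF assms(1)] decomp[OF assms(2)]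
    by (intro suminf_le split_comparison_size assms) auto
qed

end

section \<open>Balanced weights with submodular rates\<close>

text \<open>Since \<open>w\<close> is positive off the empty configuration, \<open>balance\<close>
  and \<open>weight_empty\<close> determine \<open>\<Phi>\<close> recursively. Submodularity is
  stated for two added particles, including \<open>x = y\<close> and particles already in
  \<open>\<gamma>\<close>, because configurations may have multiple points.\<close>

locale submodular_rate =
  fixes w \<Phi> :: "'b multiset \<Rightarrow> real"
  assumes rate_empty: "w {#} = 0"
    and rate_pos: "\<gamma> \<noteq> {#} \<Longrightarrow> 0 < w \<gamma>"
    and submodular: "w (add_mset x (add_mset y \<gamma>)) + w \<gamma> \<le> w (add_mset x \<gamma>) + w (add_mset y \<gamma>)"
    and weight_empty: "\<Phi> {#} = 1"
    and balance: "w \<gamma> * \<Phi> \<gamma> = (\<Sum>x\<in>#\<gamma>. \<Phi> (\<gamma> - {#x#}))"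
begin

lemma weight_pos: "0 < \<Phi> \<gamma>"
proof (induction "size \<gamma>" arbitrary: \<gamma>)
  case 0
  then show ?case by (simp add: weight_empty)
next
  case (Suc n)
  then obtain x \<gamma>' where x: "\<gamma> = add_mset x \<gamma>'"
    by (metis size_eq_Suc_imp_eq_union)
  have "0 < \<Phi> (\<gamma> - {#x#})"
    using Suc x by simp
  moreover have "0 \<le> \<Phi> (\<gamma> - {#y#})" if "y \<in># \<gamma>'" for y
    using size_Suc_Diff1[of y \<gamma>] Suc(2) that x by (intro less_imp_le Suc(1)) simp
  then have "0 \<le> (\<Sum>y\<in>#\<gamma>'. \<Phi> (\<gamma> - {#y#}))"
    using sum_mset_mono[of \<gamma>' "\<lambda>_. 0" "\<lambda>y. \<Phi> (\<gamma> - {#y#})"] by simp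
  ultimately have "0 < w \<gamma> * \<Phi> \<gamma>"
    unfolding balance using x by simp
  then show ?case
    using rate_pos[of \<gamma>] x by (simp add: zero_less_mult_iff)
qed

text \<open>With $p_z(A) = \Phi(A - z) / \Phi(A)$, whose sum over $z \in A$ is $w(A)$, the induction hypothesis
  makes $p_z(A)$ decrease when a particle is added, and then
  $(p_z(A) - p_z(A + x)) (p_z(A) - p_z(A + y)) \ge 0$ linearises the balance equation of $A + x + y$.\<close>

lemma weight_add_add:
  "\<Phi> (add_mset x A) * \<Phi> (add_mset y A) \<le> \<Phi> (add_mset x (add_mset y A)) * \<Phi> A"
proof (induction "size A" arbitrary: A x y rule: less_induct)
  case less
  define u X Y where "u = \<Phi> A" and "X = \<Phi> (add_mset x A)" and "Y = \<Phi> (add_mset y A)"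
  define Z where "Z = \<Phi> (add_mset x (add_mset y A))"
  have pos: "0 < u" "0 < X" "0 < Y" by (simp_all add: u_def X_def Y_def weight_pos)
  have rm: "add_mset a A - {#z#} = add_mset a (A - {#z#})" if "z \<in># A" for a z
    using that by simp
  have rm2: "add_mset a (add_mset b A) - {#z#} = add_mset a (add_mset b (A - {#z#}))"
    if "z \<in># A" for a b z
    by (simp add: rm that)
  have bal: "(\<Sum>z\<in>#A. \<Phi> (A - {#z#})) = w A * u"
    "(\<Sum>z\<in>#A. \<Phi> (add_mset x (A - {#z#}))) = w (add_mset x A) * X - u"
    "(\<Sum>z\<in>#A. \<Phi> (add_mset y (A - {#z#}))) = w (add_mset y A) * Y - u"
    "(\<Sum>z\<in>#A. \<Phi> (add_mset x (add_mset y (A - {#z#}))))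
      = w (add_mset x (add_mset y A)) * Z - X - Y"
  proof -
    show "(\<Sum>z\<in>#A. \<Phi> (A - {#z#})) = w A * u"
      by (simp add: u_def balance)
    have one: "(\<Sum>z\<in>#A. \<Phi> (add_mset a (A - {#z#})))
        = w (add_mset a A) * \<Phi> (add_mset a A) - u" for a
    proof -
      have "(\<Sum>z\<in>#A. \<Phi> (add_mset a (A - {#z#}))) = (\<Sum>z\<in>#A. \<Phi> (add_mset a A - {#z#}))"
        by (intro arg_cong[of _ _ sum_mset] image_mset_cong) (simp only: rm)
      then show ?thesis by (simp add: balance u_def)
    qed
    show "(\<Sum>z\<in>#A. \<Phi> (add_mset x (A - {#z#}))) = w (add_mset x A) * X - u"
      "(\<Sum>z\<in>#A. \<Phi> (add_mset y (A - {#z#}))) = w (add_mset y A) * Y - u"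
      by (simp_all only: one X_def Y_def)
    have "add_mset x (add_mset y A) - {#y#} = add_mset x A"
      by (simp add: add_mset_commute[of x y])
    moreover have "(\<Sum>z\<in>#A. \<Phi> (add_mset x (add_mset y (A - {#z#}))))
        = (\<Sum>z\<in>#A. \<Phi> (add_mset x (add_mset y A) - {#z#}))"
      by (intro arg_cong[of _ _ sum_mset] image_mset_cong) (simp only: rm2)
    ultimately show "(\<Sum>z\<in>#A. \<Phi> (add_mset x (add_mset y (A - {#z#}))))
        = w (add_mset x (add_mset y A)) * Z - X - Y"
      by (simp add: Z_def X_def Y_def balance)
  qed
  have "Y * u * \<Phi> (add_mset x (A - {#z#})) + X * u * \<Phi> (add_mset y (A - {#z#}))
      \<le> u\<^sup>2 * \<Phi> (add_mset x (add_mset y (A - {#z#}))) + X * Y * \<Phi> (A - {#z#})"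
    if z: "z \<in># A" for z
  proof -
    define B where "B = A - {#z#}"
    have A: "A = add_mset z B" using z by (simp add: B_def)
    define b bx b_y s where "b = \<Phi> B" and "bx = \<Phi> (add_mset x B)" and "b_y = \<Phi> (add_mset y B)"
      and "s = \<Phi> (add_mset x (add_mset y B))"
    have b: "0 < b" by (simp add: b_def weight_pos)
    \<comment> \<open>The induction hypothesis at \<open>B\<close> for the pairs
      \<open>x, y\<close>, then \<open>x, z\<close> and \<open>y, z\<close>. The last two make both
      factors of the product below nonnegative; that product is the one of the differences of $p_z$
      with denominators cleared. In its expansion the first inequality replaces
      \<open>bx * b_y * u\<^sup>2\<close>, and then a factor \<open>b\<close> cancels.\<close>
    have "bx * b_y \<le> s * b" "bx * u \<le> X * b" "b_y * u \<le> Y * b"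
      using less[of B x y] less[of B x z] less[of B y z]
      by (simp_all add: A b_def bx_def b_y_def s_def u_def X_def Y_def)
    then have "0 \<le> (X * b - bx * u) * (Y * b - b_y * u)" "bx * b_y * u\<^sup>2 \<le> s * b * u\<^sup>2"
      by (auto intro: mult_right_mono)
    then have "b * (Y * u * bx + X * u * b_y - X * Y * b) \<le> b * (u\<^sup>2 * s)"
      by (simp add: algebra_simps power2_eq_square)
    then show ?thesis
      using b by (simp add: B_def b_def bx_def b_y_def s_def)
  qed
  then have "(\<Sum>z\<in>#A. Y * u * \<Phi> (add_mset x (A - {#z#})) + X * u * \<Phi> (add_mset y (A - {#z#})))
      \<le> (\<Sum>z\<in>#A. u\<^sup>2 * \<Phi> (add_mset x (add_mset y (A - {#z#}))) + X * Y * \<Phi> (A - {#z#}))"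
    by (intro sum_mset_mono)
  then have "Y * u * (w (add_mset x A) * X - u) + X * u * (w (add_mset y A) * Y - u)
      \<le> u\<^sup>2 * (w (add_mset x (add_mset y A)) * Z - X - Y) + X * Y * (w A * u)"
    unfolding bal[symmetric] sum_mset_distrib_left sum_mset.distrib .
  \<comment> \<open>The terms without \<open>w\<close>, which come from removing the added particles
    themselves, cancel: both sides contain \<open>- u\<^sup>2 * (X + Y)\<close>.\<close>
  then have "u * (X * Y * (w (add_mset x A) + w (add_mset y A) - w A))
      \<le> u * (w (add_mset x (add_mset y A)) * (Z * u))"
    by (simp add: algebra_simps power2_eq_square)
  then have "X * Y * (w (add_mset x A) + w (add_mset y A) - w A)
      \<le> w (add_mset x (add_mset y A)) * (Z * u)"
    using pos by simp
  \<comment> \<open>Submodularity enters here: it leaves the same rate on both sides, which is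
    positive and cancels.\<close>
  moreover have "X * Y * w (add_mset x (add_mset y A))
      \<le> X * Y * (w (add_mset x A) + w (add_mset y A) - w A)"
    using submodular[of x y A] pos by (intro mult_left_mono) auto
  ultimately have "w (add_mset x (add_mset y A)) * (X * Y)
      \<le> w (add_mset x (add_mset y A)) * (Z * u)"
    by (simp add: mult.commute)
  then show ?case
    using rate_pos[of "add_mset x (add_mset y A)"] by (simp add: u_def X_def Y_def Z_def)
qed

text \<open>The ratio \<open>\<Phi> (add_mset x A) / \<Phi> A\<close> grows with \<open>A\<close>:
  by \<open>weight_add_add\<close> for one further particle, hence by induction for all of
  \<open>C\<close>.\<close>

lemma weight_add_union:
  "\<Phi> (add_mset x A) * \<Phi> (A + C) \<le> \<Phi> (add_mset x (A + C)) * \<Phi> A"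
proof (induction C)
  case (add y C)
  have "\<Phi> (A + C) * (\<Phi> (add_mset x A) * \<Phi> (add_mset y (A + C)))
      \<le> \<Phi> (add_mset x (A + C)) * \<Phi> A * \<Phi> (add_mset y (A + C))"
    using mult_right_mono[OF add less_imp_le[OF weight_pos[of "add_mset y (A + C)"]]]
    by (simp add: mult_ac)
  also have "\<dots> \<le> \<Phi> A * (\<Phi> (add_mset x (add_mset y (A + C))) * \<Phi> (A + C))"
    using mult_left_mono[OF weight_add_add[of x "A + C" y] less_imp_le[OF weight_pos[of A]]]
    by (simp add: mult_ac)
  finally have "\<Phi> (A + C) * (\<Phi> (add_mset x A) * \<Phi> (add_mset y (A + C)))
      \<le> \<Phi> (A + C) * (\<Phi> (add_mset x (add_mset y (A + C))) * \<Phi> A)"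
    by (simp add: mult_ac)
  then show ?case
    using weight_pos[of "A + C"] by simp
qed simp

text \<open>The ratio \<open>\<Phi> (A + B) / \<Phi> A\<close> is a telescoping product of
  one-particle ratios, each of which grows when \<open>C\<close> is added.\<close>

lemma weight_log_supermodular: "\<Phi> (A + B) * \<Phi> (A + C) \<le> \<Phi> (A + B + C) * \<Phi> A"
proof (induction B)
  case (add x B)
  have "\<Phi> (A + B) * (\<Phi> (add_mset x (A + B)) * \<Phi> (A + C))
      \<le> \<Phi> (A + B + C) * \<Phi> A * \<Phi> (add_mset x (A + B))"
    using mult_right_mono[OF add less_imp_le[OF weight_pos[of "add_mset x (A + B)"]]]
    by (simp add: mult_ac)
  also have "\<dots> \<le> \<Phi> A * (\<Phi> (add_mset x (A + B + C)) * \<Phi> (A + B))"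
    using mult_left_mono[OF weight_add_union[of x "A + B" C] less_imp_le[OF weight_pos[of A]]]
    by (simp add: mult_ac)
  finally have "\<Phi> (A + B) * (\<Phi> (add_mset x (A + B)) * \<Phi> (A + C))
      \<le> \<Phi> (A + B) * (\<Phi> (add_mset x (A + B + C)) * \<Phi> A)"
    by (simp add: mult_ac)
  then show ?case
    using weight_pos[of "A + B"] by simp
qed simp

text \<open>Shuffling two families that do not interact: the product solves the balance equation.\<close>

lemma weight_product:
  assumes additive: "\<And>R B. set_mset R \<subseteq> U \<Longrightarrow> set_mset B \<subseteq> V \<Longrightarrow> w (R + B) = w R + w B"
    and "set_mset R \<subseteq> U" "set_mset B \<subseteq> V"
  shows "\<Phi> (R + B) = \<Phi> R * \<Phi> B"
  using assms(2,3)
proof (induction "size (R + B)" arbitrary: R B rule: less_induct)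
  case less
  show ?case
  proof (cases "R + B = {#}")
    case True
    then show ?thesis by (simp add: weight_empty)
  next
    case False
    have "\<Phi> (R + B - {#x#}) = \<Phi> (R - {#x#}) * \<Phi> B" if "x \<in># R" for x
    proof -
      have "\<Phi> ((R - {#x#}) + B) = \<Phi> (R - {#x#}) * \<Phi> B"
      proof (rule less.hyps)
        show "size (R - {#x#} + B) < size (R + B)"
          unfolding size_union using size_Suc_Diff1[OF that] by linarith
      qed (use less.prems in \<open>auto dest: in_diffD\<close>)
      then show ?thesis using that by simp
    qed
    moreover have "\<Phi> (R + B - {#x#}) = \<Phi> R * \<Phi> (B - {#x#})" if "x \<in># B" for x
    proof -
      have "\<Phi> (R + (B - {#x#})) = \<Phi> R * \<Phi> (B - {#x#})"
      proof (rule less.hyps)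
        show "size (R + (B - {#x#})) < size (R + B)"
          unfolding size_union using size_Suc_Diff1[OF that] by linarith
      qed (use less.prems in \<open>auto dest: in_diffD\<close>)
      then show ?thesis using that by simp
    qed
    ultimately have "w (R + B) * \<Phi> (R + B)
        = (\<Sum>x\<in>#R. \<Phi> (R - {#x#}) * \<Phi> B) + (\<Sum>x\<in>#B. \<Phi> R * \<Phi> (B - {#x#}))"
      unfolding balance by (simp cong: image_mset_cong)
    \<comment> \<open>The balance equations of \<open>R\<close> and of \<open>B\<close> alone;
      additivity then merges the two rates into \<open>w (R + B)\<close>, which cancels.\<close>
    also have "\<dots> = (w R * \<Phi> R) * \<Phi> B + \<Phi> R * (w B * \<Phi> B)"
      by (simp add: balance sum_mset_distrib_left sum_mset_distrib_right)
    also have "\<dots> = w (R + B) * (\<Phi> R * \<Phi> B)"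
      using additive[OF less.prems] by (simp add: algebra_simps)
    finally show ?thesis
      using rate_pos[OF False] by simp
  qed
qed

end

section \<open>The stationary density\<close>

text \<open>The parametrised version with a parameter that is ignored; the configuration itself is
  inserted for it.\<close>

lemma measurable_sum_remove_point:
  assumes G: "G \<in> borel_measurable (M \<Otimes>\<^sub>M config_space M)"
  shows "(\<lambda>\<gamma>. \<Sum>x\<in>#\<gamma>. G (x, \<gamma> - {#x#}) :: ennreal) \<in> borel_measurable (config_space M)"
proof -
  have "(\<lambda>(x, \<gamma>, y :: 'a multiset). G (x, \<gamma>))
      \<in> borel_measurable (M \<Otimes>\<^sub>M (config_space M \<Otimes>\<^sub>M config_space M))"
    using G by measurable
  from measurable_sum_remove[OF this]
  have "(\<lambda>(\<gamma>, y). \<Sum>x\<in>#\<gamma>. G (x, \<gamma> - {#x#}))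
      \<in> borel_measurable (config_space M \<Otimes>\<^sub>M config_space M)" by simp
  from measurable_compose[OF _ this, of "\<lambda>\<gamma>. (\<gamma>, \<gamma>)" "config_space M"] show ?thesis
    by simp
qed

lemma permute_list_snoc:
  assumes "q permutes {..<length xs}"
  shows "permute_list q (xs @ [x]) = permute_list q xs @ [x]"
proof -
  have "q (length xs) = length xs"
    using assms by (auto simp: permutes_def)
  moreover have "q i < length xs" if "i < length xs" for i
    using permutes_in_image[OF assms, of i] that by simp
  ultimately show ?thesis
    by (auto simp: permute_list_def nth_append)
qed

section \<open>The sum over orderings and its balance equation\<close>

text \<open>The rate at which a particle of \<open>\<gamma>\<close> disappears: arrivals in its
  neighbourhood are matched, and each particle leaves at rate \<open>\<mu>\<close>. It is the
  denominator belonging to a prefix of an ordering.\<close>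

definition particle_rate :: "'a::metric_space set \<Rightarrow> 'a measure \<Rightarrow> real \<Rightarrow> ('a \<times> color) multiset \<Rightarrow> real" where
  "particle_rate D lam \<mu> \<gamma> = measure (colored lam) (nbhds D (set_mset \<gamma>)) + real (size \<gamma>) * \<mu>"

definition order_sum :: "'a::metric_space set \<Rightarrow> 'a measure \<Rightarrow> real \<Rightarrow> ('a \<times> color) multiset \<Rightarrow> real" where
  "order_sum D lam \<mu> \<gamma> = permutation_sum D lam \<mu> (SOME xs. mset xs = \<gamma>)"

lemma order_sum_mset: "order_sum D lam \<mu> (mset xs) = permutation_sum D lam \<mu> xs"
  unfolding order_sum_def by (rule permutation_sum_cong) (rule someI_ex, auto)

lemma order_weight_snoc:
  "order_weight D lam \<mu> (xs @ [x])
    = order_weight D lam \<mu> xs / particle_rate D lam \<mu> (mset (xs @ [x]))"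
proof -
  have "order_weight D lam \<mu> (xs @ [x]) = (\<Prod>i=1..Suc (length xs).
      1 / (measure (colored lam) (nbhds D (set (take i (xs @ [x])))) + real i * \<mu>))"
    by (simp add: order_weight_def)
  also have "\<dots> = (\<Prod>i=1..length xs.
      1 / (measure (colored lam) (nbhds D (set (take i (xs @ [x])))) + real i * \<mu>))
      / particle_rate D lam \<mu> (mset (xs @ [x]))"
    by (simp add: particle_rate_def)
  also have "(\<Prod>i=1..length xs. 1 / (measure (colored lam) (nbhds D (set (take i (xs @ [x])))) + real i * \<mu>))
      = order_weight D lam \<mu> xs"
    unfolding order_weight_def by (intro prod.cong) auto
  finally show ?thesis .
qed

text \<open>Orderings are grouped by their last particle. The last factor of
  \<open>order_weight\<close> depends only on the whole configuration and comes out of the sum; what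
  remains is the sum over orderings of the other particles.\<close>

lemma permutation_sum_Suc:
  assumes len: "length xs = Suc n"
  shows "permutation_sum D lam \<mu> xs
    = (\<Sum>x\<in>#mset xs. order_sum D lam \<mu> (mset xs - {#x#})) / particle_rate D lam \<mu> (mset xs)"
proof -
  have inner: "(\<Sum>q | q permutes {..<n}. order_weight D lam \<mu> (permute_list (Transposition.transpose n b \<circ> q) xs))
      = order_sum D lam \<mu> (mset xs - {#xs ! b#}) / particle_rate D lam \<mu> (mset xs)"
    if b: "b \<in> {..<Suc n}" for b
  proof -
    \<comment> \<open>The transposition brings particle \<open>b\<close> to the last place;
      \<open>q\<close> then permutes only the \<open>n\<close> places before it.\<close>
    define ys where "ys = permute_list (Transposition.transpose n b) xs"
    have t: "Transposition.transpose n b permutes {..<length xs}"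
      using b len by (intro permutes_swap_id) auto
    have ys: "mset ys = mset xs" "length ys = Suc n" "ys ! n = xs ! b"
      using t len by (auto simp: ys_def permute_list_nth)
    define zs where "zs = butlast ys"
    have ys_snoc: "ys = zs @ [xs ! b]"
      using ys(2,3) by (metis zs_def append_butlast_last_id diff_Suc_1 last_conv_nth length_0_conv nat.distinct(1))
    have zs: "length zs = n" using ys(2) by (simp add: zs_def)
    have "order_weight D lam \<mu> (permute_list (Transposition.transpose n b \<circ> q) xs)
        = order_weight D lam \<mu> (permute_list q zs) / particle_rate D lam \<mu> (mset xs)"
      if q: "q permutes {..<n}" for q
    proof -
      have "q permutes {..<length xs}"
        using q len by (auto intro: permutes_subset)
      then have "permute_list (Transposition.transpose n b \<circ> q) xs = permute_list q ys"
        by (simp add: ys_def permute_list_compose)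
      also have "\<dots> = permute_list q zs @ [xs ! b]"
        unfolding ys_snoc using q zs by (intro permute_list_snoc) simp
      finally have "permute_list (Transposition.transpose n b \<circ> q) xs = permute_list q zs @ [xs ! b]" .
      moreover have "mset (permute_list q zs @ [xs ! b]) = mset xs"
        using q zs ys(1) by (simp add: ys_snoc)
      ultimately show ?thesis
        by (simp only: order_weight_snoc)
    qed
    then have "(\<Sum>q | q permutes {..<n}. order_weight D lam \<mu> (permute_list (Transposition.transpose n b \<circ> q) xs))
        = permutation_sum D lam \<mu> zs / particle_rate D lam \<mu> (mset xs)"
      unfolding permutation_sum_def zs sum_divide_distrib by (intro sum.cong) auto
    also have "mset zs = mset xs - {#xs ! b#}"
      using ys(1) by (metis ys_snoc add_diff_cancel_right' mset.simps mset_append)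
    then have "permutation_sum D lam \<mu> zs = order_sum D lam \<mu> (mset xs - {#xs ! b#})"
      by (simp flip: order_sum_mset)
    finally show ?thesis .
  qed
  have "permutation_sum D lam \<mu> xs = (\<Sum>b\<in>insert n {..<n}.
      \<Sum>q | q permutes {..<n}. order_weight D lam \<mu> (permute_list (Transposition.transpose n b \<circ> q) xs))"
    unfolding permutation_sum_def len lessThan_Suc by (rule sum_over_permutations_insert) auto
  also have "\<dots> = (\<Sum>b<Suc n. order_sum D lam \<mu> (mset xs - {#xs ! b#}) / particle_rate D lam \<mu> (mset xs))"
    unfolding lessThan_Suc[symmetric] by (intro sum.cong inner) auto
  also have "\<dots> = (\<Sum>b<length xs. order_sum D lam \<mu> (mset xs - {#xs ! b#})) / particle_rate D lam \<mu> (mset xs)"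
    by (simp only: len sum_divide_distrib)
  also have "(\<Sum>b<length xs. order_sum D lam \<mu> (mset xs - {#xs ! b#}))
      = (\<Sum>x\<in>#mset xs. order_sum D lam \<mu> (mset xs - {#x#}))"
    unfolding mset_map[symmetric] sum_mset_sum_list by (simp add: sum_list_sum_nth atLeast0LessThan)
  finally show ?thesis .
qed

text \<open>The union of finite nets of radius \<open>1 / (n + 1)\<close>. Separability is what
  makes the matching relation measurable in the product \<sigma>-algebra.\<close>

lemma countable_dense_compact:
  fixes D :: "'a::metric_space set"
  assumes "compact D"
  obtains S where "countable S" "S \<subseteq> D" "\<And>x e. x \<in> D \<Longrightarrow> 0 < e \<Longrightarrow> \<exists>q\<in>S. dist q x < e"
proof -
  have "\<exists>k. finite k \<and> k \<subseteq> D \<and> D \<subseteq> (\<Union>x\<in>k. ball x (1 / real (Suc n)))" for n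
    using seq_compact_imp_totally_bounded[of D] assms
    by (metis compact_eq_seq_compact_metric of_nat_0_less_iff zero_less_Suc zero_less_divide_1_iff)
  then obtain k where k: "\<And>n. finite (k n)" "\<And>n. k n \<subseteq> D"
    "\<And>n. D \<subseteq> (\<Union>x\<in>k n. ball x (1 / real (Suc n)))"
    by metis
  show thesis
  proof
    show "countable (\<Union>n. k n)" "(\<Union>n. k n) \<subseteq> D"
      using k by (auto intro: countable_finite)
    fix x :: 'a and e :: real assume "x \<in> D" "0 < e"
    obtain n where n: "1 / real (Suc n) < e"
      using \<open>0 < e\<close> nat_approx_posE by blast
    obtain q where "q \<in> k n" "dist q x < 1 / real (Suc n)"
      using k(3)[of n] \<open>x \<in> D\<close> by (auto simp: mem_ball)
    then show "\<exists>q\<in>\<Union>n. k n. dist q x < e"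
      using n by (intro bexI[of _ q]) auto
  qed
qed

section \<open>The matching geometry and measurability of the density\<close>

locale matching_space =
  fixes D :: "'a::metric_space set" and lam :: "'a measure" and \<mu> :: real
  assumes compact: "compact D" and radon: "radon_measure_on D lam" and \<mu>_pos: "0 < \<mu>"
begin

lemma space_lam: "space lam = D"
  using radon sets_eq_imp_space_eq[of lam "restrict_space borel D"]
  by (simp add: radon_measure_on_def space_restrict_space)

lemma space_colored: "space (colored lam) = D \<times> UNIV"
  by (simp add: colored_def space_pair_measure space_lam)

lemma sets_ball: "ball x r \<inter> D \<in> sets lam"
proof -
  have "ball x r \<inter> D \<in> sets (restrict_space borel D)"
    unfolding sets_restrict_space by (rule image_eqI[of _ _ "ball x r"]) auto
  then show ?thesis
    using radon by (simp add: radon_measure_on_def)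
qed

lemma finite_measure_lam: "finite_measure lam"
proof (rule finite_measureI)
  show "emeasure lam (space lam) \<noteq> \<infinity>"
  proof -
    have "\<forall>K. K \<subseteq> D \<and> compact K \<longrightarrow> emeasure lam K < \<infinity>"
      using radon unfolding radon_measure_on_def by blast
    then have "emeasure lam D < \<infinity>"
      using compact by blast
    then show ?thesis by (simp add: space_lam)
  qed
qed

lemma color_UNIV: "(UNIV :: color set) = {Red, Blue}"
  using color.exhaust by auto

sublocale finite_measure "colored lam"
proof (rule finite_measureI)
  interpret L: finite_measure lam by (rule finite_measure_lam)
  interpret C: finite_measure "count_space (UNIV :: color set)"
    by (rule finite_measure_count_space) (simp add: color_UNIV)
  have "emeasure (colored lam) (space (colored lam))
      = emeasure lam (space lam) * emeasure (count_space UNIV) (UNIV :: color set)"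
    unfolding colored_def space_pair_measure space_count_space
    by (rule C.emeasure_pair_measure_Times) auto
  then show "emeasure (colored lam) (space (colored lam)) \<noteq> \<infinity>"
    using L.emeasure_finite C.emeasure_finite by (simp add: ennreal_mult_eq_top_iff)
qed

lemma nbhd_eq: "nbhd D x = (ball (fst x) 1 \<inter> D) \<times> {opp (snd x)}"
  by (auto simp: nbhd_def)

lemma sets_nbhd [measurable]: "nbhd D x \<in> sets (colored lam)"
  unfolding nbhd_eq colored_def using sets_ball by auto

lemma sets_nbhds [measurable]: "finite A \<Longrightarrow> nbhds D A \<in> sets (colored lam)"
  unfolding nbhds_def by (intro sets.finite_UN sets_nbhd)

abbreviation "rate \<equiv> particle_rate D lam \<mu>"
abbreviation "weight \<equiv> order_sum D lam \<mu>"

text \<open>The measure of a union of neighbourhoods is submodular: the two enlarged neighbourhoods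
  intersect in a set containing that of \<open>\<gamma>\<close>. The departure part of the rate is
  additive and balances exactly. The balance equation is \<open>permutation_sum_Suc\<close>
  multiplied by the rate.\<close>

sublocale submodular_rate rate weight
proof
  show "rate {#} = 0"
    by (simp add: particle_rate_def nbhds_def)
  show pos: "0 < rate \<gamma>" if "\<gamma> \<noteq> {#}" for \<gamma>
    using that \<mu>_pos by (auto simp: particle_rate_def nonempty_has_size intro!: add_nonneg_pos)
  show "rate (add_mset x (add_mset y \<gamma>)) + rate \<gamma> \<le> rate (add_mset x \<gamma>) + rate (add_mset y \<gamma>)" for x y \<gamma>
  proof -
    let ?m = "measure (colored lam)"
    let ?C = "nbhds D (set_mset \<gamma>)"
    let ?A = "nbhd D x \<union> ?C" and ?B = "nbhd D y \<union> ?C"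
    have "?m (?A \<union> ?B) = ?m ?A + ?m (?B - ?A)"
      by (rule finite_measure_Union') auto
    moreover have "?m ?B = ?m (?B \<inter> ?A) + ?m (?B - ?A)"
      by (subst finite_measure_Union[symmetric]) (auto intro!: arg_cong[of _ _ ?m])
    moreover have "?m ?C \<le> ?m (?B \<inter> ?A)"
      by (rule finite_measure_mono) auto
    ultimately have "?m (nbhd D x \<union> (nbhd D y \<union> ?C)) + ?m ?C \<le> ?m ?A + ?m ?B"
      by (simp add: Un_ac)
    then show ?thesis
      by (simp add: particle_rate_def nbhds_def algebra_simps)
  qed
  show "weight {#} = 1"
    using order_sum_mset[of D lam \<mu> "[]"] by (simp add: permutation_sum_def order_weight_def)
  show "rate \<gamma> * weight \<gamma> = (\<Sum>x\<in>#\<gamma>. weight (\<gamma> - {#x#}))" for \<gamma>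
  proof -
    obtain xs where xs: "mset xs = \<gamma>" using ex_mset by blast
    show ?thesis
    proof (cases "length xs")
      case 0
      then show ?thesis using xs by (simp add: particle_rate_def nbhds_def)
    next
      case (Suc n)
      then have "\<gamma> \<noteq> {#}" using xs by auto
      then show ?thesis
        using permutation_sum_Suc[OF Suc, of D lam \<mu>] pos[of \<gamma>] by (simp add: xs order_sum_mset[symmetric])
    qed
  qed
qed

text \<open>Neighbourhoods of red particles are blue and those of blue particles are red, so they
  are disjoint and their measures add.\<close>

lemma rate_union_colors:
  assumes "set_mset R \<subseteq> {x. snd x = Red}" "set_mset B \<subseteq> {x. snd x = Blue}"
  shows "rate (R + B) = rate R + rate B"
proof -
  have "nbhds D (set_mset R) \<inter> nbhds D (set_mset B) = {}"
    using assms by (fastforce simp: nbhds_def nbhd_def)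
  moreover have "nbhds D (set_mset (R + B)) = nbhds D (set_mset R) \<union> nbhds D (set_mset B)"
    by (auto simp: nbhds_def)
  ultimately show ?thesis
    by (simp add: particle_rate_def finite_measure_Union algebra_simps)
qed

text \<open>Since \<open>nbhd\<close> confines only its second point to \<open>D\<close>, the
  condition \<open>fst x \<in> D\<close> is what keeps the relation inside the product
  space.\<close>

definition compatibility :: "(('a \<times> color) \<times> ('a \<times> color)) set" where
  "compatibility = {(x, y). fst x \<in> D \<and> y \<in> nbhd D x}"

text \<open>The inequality \<open>dist p p' < 1\<close> is strict, which leaves room for a centre
  \<open>q\<close> from the dense set and a rational radius: the relation is a countable union of
  rectangles of balls.\<close>

lemma sets_compatibility: "compatibility \<in> sets (colored lam \<Otimes>\<^sub>M colored lam)"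
proof -
  obtain S where S: "countable S" "S \<subseteq> D" "\<And>x e. x \<in> D \<Longrightarrow> 0 < e \<Longrightarrow> \<exists>q\<in>S. dist q x < e"
    using countable_dense_compact[OF compact] by blast
  define B where "B q r c = (ball q r \<inter> D) \<times> {c}" for q r and c :: color
  have B: "B q r c \<in> sets (colored lam)" for q r c
    unfolding B_def colored_def using sets_ball by auto
  have "compatibility = (\<Union>q\<in>S. \<Union>r\<in>\<rat>. \<Union>c\<in>UNIV. B q r c \<times> B q (1 - r) (opp c))" (is "_ = ?U")
  proof (intro equalityI subsetI)
    fix z assume "z \<in> compatibility"
    then obtain p c p' where z: "z = ((p, c), (p', opp c))" "p \<in> D" "p' \<in> D" "dist p p' < 1"
      by (cases z) (auto simp: compatibility_def nbhd_def)
    \<comment> \<open>Half of the slack: one \<open>e\<close> pays for moving from \<open>p\<close>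
      to \<open>q\<close>, the other for the radius \<open>r\<close>, so that
      \<open>dist q p' < 1 - r\<close>.\<close>
    define e where "e = (1 - dist p p') / 2"
    have "0 < e" using z by (simp add: e_def)
    obtain q where q: "q \<in> S" "dist q p < e"
      using S(3)[OF z(2) \<open>0 < e\<close>] by auto
    obtain r where r: "r \<in> \<rat>" "dist q p < r" "r < e"
      using Rats_dense_in_real[OF q(2)] by auto
    have "dist q p' \<le> dist q p + dist p p'"
      by (rule dist_triangle)
    also have "\<dots> < 1 - r"
      using q(2) r(3) by (simp add: e_def field_simps)
    finally have "z \<in> B q r c \<times> B q (1 - r) (opp c)"
      using z r by (simp add: B_def)
    then show "z \<in> ?U" using q(1) r(1) by blast
  next
    fix z assume "z \<in> ?U"
    then obtain q r c where "z \<in> B q r c \<times> B q (1 - r) (opp c)" by blast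
    then obtain p p' where z: "z = ((p, c), (p', opp c))" "p \<in> D" "p' \<in> D" "dist q p < r" "dist q p' < 1 - r"
      by (auto simp: B_def)
    have "dist p p' \<le> dist q p + dist q p'"
      by (rule dist_triangle3)
    then show "z \<in> compatibility"
      using z by (simp add: compatibility_def nbhd_def)
  qed
  moreover have "countable (UNIV :: color set)"
    by (rule countable_finite) (simp add: color_UNIV)
  ultimately show ?thesis
    using S(1) B by (auto intro!: sets.countable_UN'' pair_measureI simp: countable_rat)
qed

lemma compatibility_iff: "x \<in> space (colored lam) \<Longrightarrow> (x, y) \<in> compatibility \<longleftrightarrow> y \<in> nbhd D x"
  by (auto simp: compatibility_def space_colored)

lemma measurable_compatible_sum:
  "(\<lambda>(\<gamma>, y). \<Sum>x\<in>#\<gamma>. indicator compatibility (x, y) :: ennreal)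
    \<in> borel_measurable (config_space (colored lam) \<Otimes>\<^sub>M colored lam)"
proof -
  note sets_compatibility[measurable]
  have "(\<lambda>(x, \<gamma> :: ('a \<times> color) multiset, y). indicator compatibility (x, y) :: ennreal)
      \<in> borel_measurable (colored lam \<Otimes>\<^sub>M (config_space (colored lam) \<Otimes>\<^sub>M colored lam))"
    by measurable
  from measurable_sum_remove[OF this] show ?thesis by simp
qed

lemma sum_mset_ennreal_eq_0: "(\<Sum>x\<in>#A. f x :: ennreal) = 0 \<longleftrightarrow> (\<forall>x\<in>#A. f x = 0)"
  by (induction A) auto

lemma measurable_rate: "rate \<in> borel_measurable (config_space (colored lam))"
proof -
  let ?C = "config_space (colored lam)"
  define s :: "('a \<times> color) multiset \<Rightarrow> 'a \<times> color \<Rightarrow> ennreal"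
    where "s \<gamma> y = (\<Sum>x\<in>#\<gamma>. indicator compatibility (x, y))" for \<gamma> y
  have [measurable]: "(\<lambda>(\<gamma>, y). s \<gamma> y) \<in> borel_measurable (?C \<Otimes>\<^sub>M colored lam)"
    unfolding s_def by (rule measurable_compatible_sum)
  have "(\<lambda>\<gamma>. \<integral>\<^sup>+y. (if s \<gamma> y = 0 then 0 else 1) \<partial>colored lam) \<in> borel_measurable ?C"
    by (rule borel_measurable_nn_integral) measurable
  moreover have "(\<integral>\<^sup>+y. (if s \<gamma> y = 0 then 0 else 1) \<partial>colored lam)
      = emeasure (colored lam) (nbhds D (set_mset \<gamma>))" if "\<gamma> \<in> space ?C" for \<gamma>
  proof -
    have "(if s \<gamma> y = 0 then 0 else 1) = (indicator (nbhds D (set_mset \<gamma>)) y :: ennreal)" for y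
      using that configurations_member[of \<gamma> "colored lam"]
      by (auto simp: s_def sum_mset_ennreal_eq_0 nbhds_def compatibility_iff indicator_def
          split: if_splits)
    then show ?thesis by simp
  qed
  ultimately have [measurable]: "(\<lambda>\<gamma>. emeasure (colored lam) (nbhds D (set_mset \<gamma>))) \<in> borel_measurable ?C"
    by (rule measurable_cong[THEN iffD1, rotated])
  have [measurable]: "(\<lambda>\<gamma>. real (size \<gamma>)) \<in> borel_measurable ?C"
    by (rule measurable_compose[OF measurable_size_config]) simp
  show ?thesis
    unfolding particle_rate_def measure_def by measurable
qed

text \<open>A configuration is valid iff its number of compatible ordered pairs is zero, and this
  number is an iterated sum over removed points.\<close>

lemma sets_valid: "{\<gamma> \<in> configurations (colored lam). valid D \<gamma>} \<in> sets (config_space (colored lam))"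
proof -
  let ?C = "config_space (colored lam)"
  let ?s = "\<lambda>\<gamma>. \<Sum>x\<in>#\<gamma>. \<Sum>z\<in>#\<gamma> - {#x#}. indicator compatibility (z, x) :: ennreal"
  have "(\<lambda>(x, \<gamma>). \<Sum>z\<in>#\<gamma>. indicator compatibility (z, x) :: ennreal) \<in> borel_measurable (colored lam \<Otimes>\<^sub>M ?C)"
    using measurable_compose[OF measurable_pair_swap' measurable_compatible_sum] by (simp add: case_prod_beta)
  from measurable_sum_remove_point[OF this] have [measurable]: "?s \<in> borel_measurable ?C" by simp
  have "valid D \<gamma> \<longleftrightarrow> ?s \<gamma> = 0" if \<gamma>: "\<gamma> \<in> configurations (colored lam)" for \<gamma>
  proof -
    \<comment> \<open>Removing \<open>x\<close> loses no conflict of \<open>x\<close>: neighbours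
      have opposite colors, so no particle is its own neighbour.\<close>
    have rm: "z \<in># \<gamma> - {#x#}" if "z \<in># \<gamma>" "x \<in> nbhd D z" for x z
    proof -
      have "x \<noteq> z" using that(2) by (cases "snd z") (auto simp: nbhd_def)
      then show ?thesis using that(1) by (simp add: in_diff_count)
    qed
    have "valid D \<gamma> \<longleftrightarrow> (\<forall>x\<in>#\<gamma>. \<forall>z\<in>#\<gamma>. x \<notin> nbhd D z)"
      by (auto simp: valid_def nbhds_def)
    also have "\<dots> \<longleftrightarrow> (\<forall>x\<in>#\<gamma>. \<forall>z\<in>#\<gamma> - {#x#}. x \<notin> nbhd D z)"
      using rm by (meson in_diffD)
    also have "\<dots> \<longleftrightarrow> (\<forall>x\<in>#\<gamma>. \<forall>z\<in>#\<gamma> - {#x#}. (z, x) \<notin> compatibility)"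
      using configurations_member[OF \<gamma>] by (meson compatibility_iff in_diffD)
    also have "\<dots> \<longleftrightarrow> ?s \<gamma> = 0"
      by (simp add: sum_mset_ennreal_eq_0 indicator_eq_0_iff)
    finally show ?thesis .
  qed
  then have "{\<gamma> \<in> configurations (colored lam). valid D \<gamma>} = {\<gamma> \<in> space ?C. ?s \<gamma> = 0}" by auto
  also have "\<dots> \<in> sets ?C" by measurable
  finally show ?thesis .
qed

text \<open>The balance equation, divided by the rate, computes the weight at size
  \<open>n + 1\<close> from weights at size \<open>n\<close>. The indicator confines the claim to
  one size, so that induction applies.\<close>

lemma measurable_weight_size:
  "(\<lambda>\<gamma>. ennreal (weight \<gamma>) * indicator {n} (size \<gamma>)) \<in> borel_measurable (config_space (colored lam))"
proof (induction n)
  case 0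
  have "(\<lambda>\<gamma>. indicator {0} (size \<gamma>) :: ennreal) \<in> borel_measurable (config_space (colored lam))"
    by (rule measurable_compose[OF measurable_size_config]) simp
  moreover have "ennreal (weight \<gamma>) * indicator {0} (size \<gamma>) = indicator {0} (size \<gamma>)" for \<gamma>
    by (simp add: indicator_def weight_empty)
  ultimately show ?case by simp
next
  case (Suc n)
  let ?C = "config_space (colored lam)"
  note Suc.IH[measurable] measurable_rate[measurable]
  have "(\<lambda>(x, \<gamma>). ennreal (weight \<gamma>) * indicator {n} (size \<gamma>)) \<in> borel_measurable (colored lam \<Otimes>\<^sub>M ?C)"
    by measurable
  from measurable_sum_remove_point[OF this]
  have [measurable]: "(\<lambda>\<gamma>. \<Sum>x\<in>#\<gamma>. ennreal (weight (\<gamma> - {#x#})) * indicator {n} (size (\<gamma> - {#x#})))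
      \<in> borel_measurable ?C" by simp
  have [measurable]: "(\<lambda>\<gamma>. indicator {Suc n} (size \<gamma>) :: ennreal) \<in> borel_measurable ?C"
    by (rule measurable_compose[OF measurable_size_config]) simp
  have "ennreal (weight \<gamma>) * indicator {Suc n} (size \<gamma>)
      = ennreal (1 / rate \<gamma>) * (\<Sum>x\<in>#\<gamma>. ennreal (weight (\<gamma> - {#x#})) * indicator {n} (size (\<gamma> - {#x#})))
        * indicator {Suc n} (size \<gamma>)" for \<gamma>
  proof (cases "size \<gamma> = Suc n")
    case True
    then have "\<gamma> \<noteq> {#}" by auto
    have sums: "(\<Sum>x\<in>#A. ennreal (weight (\<gamma> - {#x#}))) = ennreal (\<Sum>x\<in>#A. weight (\<gamma> - {#x#}))
        \<and> 0 \<le> (\<Sum>x\<in>#A. weight (\<gamma> - {#x#}))" for A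
      by (induction A) (auto simp: less_imp_le[OF weight_pos] add_nonneg_nonneg)
    have "(\<Sum>x\<in>#\<gamma>. ennreal (weight (\<gamma> - {#x#})) * indicator {n} (size (\<gamma> - {#x#})))
        = (\<Sum>x\<in>#\<gamma>. ennreal (weight (\<gamma> - {#x#})))"
      using True by (intro arg_cong[of _ _ sum_mset] image_mset_cong) (simp add: size_Diff_singleton)
    also have "\<dots> = ennreal (rate \<gamma> * weight \<gamma>)"
      using sums by (simp add: balance)
    also have "ennreal (1 / rate \<gamma>) * ennreal (rate \<gamma> * weight \<gamma>) = ennreal (weight \<gamma>)"
      using rate_pos[OF \<open>\<gamma> \<noteq> {#}\<close>] by (simp flip: ennreal_mult')
    finally show ?thesis using True by simp
  qed simp
  moreover have "(\<lambda>\<gamma>. ennreal (1 / rate \<gamma>)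
      * (\<Sum>x\<in>#\<gamma>. ennreal (weight (\<gamma> - {#x#})) * indicator {n} (size (\<gamma> - {#x#})))
      * indicator {Suc n} (size \<gamma>)) \<in> borel_measurable ?C"
    by measurable
  ultimately show ?case by simp
qed

lemma measurable_weight: "weight \<in> borel_measurable (config_space (colored lam))"
proof -
  have "(\<lambda>\<gamma>. ennreal (weight \<gamma>) * indicator {size \<gamma>} (size \<gamma>))
      \<in> borel_measurable (config_space (colored lam))"
    by (rule measurable_compose_countable[OF measurable_weight_size measurable_size_config])
  then have "(\<lambda>\<gamma>. enn2real (ennreal (weight \<gamma>))) \<in> borel_measurable (config_space (colored lam))"
    by simp
  then show ?thesis
    by (simp add: less_imp_le[OF weight_pos])
qed

lemma fifm_density_eq:
  "fifm_density D lam \<mu> K \<gamma> = K * (if valid D \<gamma> then weight \<gamma> else 0)"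
  by (simp add: fifm_density_def order_sum_def)

lemma measurable_fifm_density:
  "fifm_density D lam \<mu> K \<in> borel_measurable (config_space (colored lam))"
proof -
  note measurable_weight[measurable] sets_valid[measurable]
  have "(\<lambda>\<gamma>. K * (weight \<gamma> * indicator {\<gamma> \<in> configurations (colored lam). valid D \<gamma>} \<gamma>))
      \<in> borel_measurable (config_space (colored lam))"
    by measurable
  then show ?thesis
    by (rule measurable_cong[THEN iffD1, rotated]) (simp add: fifm_density_eq indicator_def)
qed

end

section \<open>Positive association\<close>

context matching_space
begin

context
  fixes p :: "nat \<Rightarrow> 'a \<times> color" and n :: nat
begin

text \<open>Splittings of the particles \<open>p 0, \<dots>, p (n - 1)\<close> are parametrised so that inclusion of index sets
  becomes the order on configurations: red particles are taken from \<open>S\<close>, blue ones from its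
  complement.\<close>

definition orient :: "nat set \<Rightarrow> nat set" where
  "orient S = {i \<in> {..<n}. if snd (p i) = Red then i \<in> S else i \<notin> S}"

definition particles :: "nat set \<Rightarrow> ('a \<times> color) multiset" where
  "particles S = image_mset p (mset_set S)"

definition config_of :: "nat set \<Rightarrow> ('a \<times> color) multiset" where
  "config_of S = particles (orient S)"

definition reds :: "nat set" where "reds = {i \<in> {..<n}. snd (p i) = Red}"
definition blues :: "nat set" where "blues = {i \<in> {..<n}. snd (p i) = Blue}"

lemma particles_union: "finite S \<Longrightarrow> finite T \<Longrightarrow> S \<inter> T = {} \<Longrightarrow> particles (S \<union> T) = particles S + particles T"
  by (simp add: particles_def mset_set_Union)

lemma orient_split: "orient S = (reds \<inter> S) \<union> (blues - S)"
proof -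
  have "snd (p i) = Red \<or> snd (p i) = Blue" for i
    by (cases "snd (p i)") auto
  then show ?thesis
    by (auto simp: orient_def reds_def blues_def)
qed

lemma finite_reds [simp]: "finite reds" and finite_blues [simp]: "finite blues"
  by (simp_all add: reds_def blues_def)

lemma finite_orient [simp]: "finite (orient S)"
  by (simp add: orient_def)

lemma config_of_split: "config_of S = particles (reds \<inter> S) + particles (blues - S)"
  unfolding config_of_def orient_split
  by (rule particles_union) (auto simp: reds_def blues_def)

lemma set_particles: "finite S \<Longrightarrow> set_mset (particles S) = p ` S"
  by (simp add: particles_def)

lemma weight_config_of: "weight (config_of S) = weight (particles (reds \<inter> S)) * weight (particles (blues - S))"
  unfolding config_of_split
  by (rule weight_product[OF rate_union_colors]) (auto simp: set_particles reds_def blues_def)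

text \<open>For index sets, \<open>S\<close> and \<open>T\<close> extend \<open>S \<inter> T\<close>
  by the disjoint parts \<open>S - T\<close> and \<open>T - S\<close>, which gives exact multiset
  sums even if \<open>p\<close> is not injective. These are the three arguments of
  \<open>weight_log_supermodular\<close>.\<close>

lemma weight_particles_lattice:
  assumes "finite S" "finite T"
  shows "weight (particles S) * weight (particles T)
    \<le> weight (particles (S \<union> T)) * weight (particles (S \<inter> T))"
proof -
  have split: "particles A = particles (A \<inter> B) + particles (A - B)" if "finite A" for A B
    using particles_union[of "A \<inter> B" "A - B"] that by (simp add: Int_Diff_Un Int_Diff_disjoint)
  have "particles S = particles (S \<inter> T) + particles (S - T)"
    "particles T = particles (S \<inter> T) + particles (T - S)"
    using split[of S T] split[of T S] assms by (simp_all add: Int_commute)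
  moreover have "particles (S \<union> T) = particles S + particles (T - S)"
    using split[of "S \<union> T" S] assms by (simp add: Int_absorb1 Un_Diff)
  ultimately show ?thesis
    using weight_log_supermodular[of "particles (S \<inter> T)" "particles (S - T)" "particles (T - S)"]
    by simp
qed

text \<open>Only pairs of opposite color can conflict. In this form validity visibly passes to
  \<open>S \<union> T\<close> and \<open>S \<inter> T\<close>: a red index of the union lies in one
  of the sets while the blue index lies outside both, and dually for the intersection.\<close>

lemma valid_config_of:
  "valid D (config_of S) \<longleftrightarrow> (\<forall>i\<in>reds \<inter> S. \<forall>j\<in>blues - S. p i \<notin> nbhd D (p j) \<and> p j \<notin> nbhd D (p i))"
proof -
  have set: "set_mset (config_of S) = p ` (reds \<inter> S) \<union> p ` (blues - S)"
    by (simp add: config_of_split set_particles)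
  have same: "p i \<notin> nbhd D (p j)" if "i \<in> reds \<and> j \<in> reds \<or> i \<in> blues \<and> j \<in> blues" for i j
    using that by (auto simp: nbhd_def reds_def blues_def)
  have "valid D (config_of S)
      \<longleftrightarrow> (\<forall>x\<in>set_mset (config_of S). \<forall>y\<in>set_mset (config_of S). x \<notin> nbhd D y)"
    by (auto simp: valid_def nbhds_def)
  also have "\<dots> \<longleftrightarrow> (\<forall>i\<in>(reds \<inter> S) \<union> (blues - S). \<forall>j\<in>(reds \<inter> S) \<union> (blues - S). p i \<notin> nbhd D (p j))"
    unfolding set by (simp add: ball_Un)
  also have "\<dots> \<longleftrightarrow> (\<forall>i\<in>reds \<inter> S. \<forall>j\<in>blues - S. p i \<notin> nbhd D (p j) \<and> p j \<notin> nbhd D (p i))"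
    using same by blast
  finally show ?thesis .
qed

text \<open>The weight factors into a red and a blue part. Passing to complements exchanges union
  and intersection for the blue part, but the product of the two values is symmetric in them. If one
  of the given configurations is invalid, the left side is 0.\<close>

lemma density_lattice:
  assumes "0 \<le> K"
  shows "fifm_density D lam \<mu> K (config_of S) * fifm_density D lam \<mu> K (config_of T)
    \<le> fifm_density D lam \<mu> K (config_of (S \<union> T)) * fifm_density D lam \<mu> K (config_of (S \<inter> T))"
proof (cases "valid D (config_of S) \<and> valid D (config_of T)")
  case True
  then have valid: "valid D (config_of (S \<union> T))" "valid D (config_of (S \<inter> T))"
    unfolding valid_config_of by blast+
  have "weight (particles (reds \<inter> S)) * weight (particles (reds \<inter> T))
      \<le> weight (particles (reds \<inter> (S \<union> T))) * weight (particles (reds \<inter> (S \<inter> T)))"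
    using weight_particles_lattice[of "reds \<inter> S" "reds \<inter> T"]
    by (simp add: Int_Un_distrib Int_Un_distrib2 Int_ac)
  moreover have "weight (particles (blues - S)) * weight (particles (blues - T))
      \<le> weight (particles (blues - (S \<inter> T))) * weight (particles (blues - (S \<union> T)))"
    using weight_particles_lattice[of "blues - S" "blues - T"]
    by (simp add: Diff_Int Diff_Un)
  ultimately have "(weight (particles (reds \<inter> S)) * weight (particles (reds \<inter> T)))
      * (weight (particles (blues - S)) * weight (particles (blues - T)))
    \<le> (weight (particles (reds \<inter> (S \<union> T))) * weight (particles (reds \<inter> (S \<inter> T))))
      * (weight (particles (blues - (S \<inter> T))) * weight (particles (blues - (S \<union> T))))"
    by (rule mult_mono) (simp_all add: less_imp_le[OF weight_pos])
  then have "weight (config_of S) * weight (config_of T) \<le> weight (config_of (S \<union> T)) * weight (config_of (S \<inter> T))"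
    by (simp add: weight_config_of mult_ac)
  then have "(K * K) * (weight (config_of S) * weight (config_of T))
      \<le> (K * K) * (weight (config_of (S \<union> T)) * weight (config_of (S \<inter> T)))"
    by (rule mult_left_mono) simp
  then show ?thesis
    using True valid by (simp add: fifm_density_eq mult_ac)
next
  case False
  then show ?thesis
    using assms by (auto simp: fifm_density_eq less_imp_le[OF weight_pos])
qed

lemma config_of_mono:
  assumes "S \<subseteq> T"
  shows "config_ge (config_of T) (config_of S)"
proof -
  have parts: "color_part Red (config_of S) = particles (reds \<inter> S)"
    "color_part Blue (config_of S) = particles (blues - S)" for S
  proof -
    have "filter_mset (\<lambda>x. snd x = Red) (particles (reds \<inter> S)) = particles (reds \<inter> S)"
      "filter_mset (\<lambda>x. snd x = Red) (particles (blues - S)) = {#}"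
      "filter_mset (\<lambda>x. snd x = Blue) (particles (reds \<inter> S)) = {#}"
      "filter_mset (\<lambda>x. snd x = Blue) (particles (blues - S)) = particles (blues - S)"
      by (auto simp: filter_mset_eq_conv set_particles reds_def blues_def)
    then show "color_part Red (config_of S) = particles (reds \<inter> S)"
      "color_part Blue (config_of S) = particles (blues - S)"
      by (simp_all add: color_part_def config_of_split)
  qed
  have sub: "particles A \<subseteq># particles B" if "A \<subseteq> B" "finite B" for A B
    unfolding particles_def using that by (intro image_mset_subseteq_mono subset_imp_msubset_mset_set)
  show ?thesis
    unfolding config_ge_def parts using assms by (auto intro!: sub)
qed

lemma config_of_space: "p ` {..<n} \<subseteq> space (colored lam) \<Longrightarrow> config_of S \<in> configurations (colored lam)"
  by (auto simp: configurations_def config_of_def set_particles orient_def)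

text \<open>On subsets of the index set \<open>orient\<close> is an involution that commutes with
  complements, so it only reindexes the splittings.\<close>

lemma split_sum_orient:
  "split_sum n h p = (\<Sum>S\<in>Pow {..<n}. h (config_of S, config_of ({..<n} - S)))"
proof -
  have inv: "orient (orient S) = S" if "S \<in> Pow {..<n}" for S
    using that by (auto simp: orient_def split: if_splits)
  have "orient ({..<n} - S) = {..<n} - orient S" for S
    by (auto simp: orient_def split: if_splits)
  then have "(\<Sum>S\<in>Pow {..<n}. h (config_of S, config_of ({..<n} - S)))
      = (\<Sum>S\<in>Pow {..<n}. h (particles (orient S), particles ({..<n} - orient S)))"
    by (simp add: config_of_def)
  also have "\<dots> = (\<Sum>S\<in>Pow {..<n}. h (particles S, particles ({..<n} - S)))"
    by (rule sum.reindex_bij_witness[of _ orient orient]) (auto simp: inv orient_def)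
  finally show ?thesis
    by (simp add: split_sum_def particles_def)
qed

text \<open>FKG for the pair weight \<open>w\<close>, which inherits log-supermodularity because
  complementation swaps union and intersection. The differences \<open>F\<close> and
  \<open>G\<close> are increasing because enlarging \<open>S\<close> shrinks
  \<open>I - S\<close>.\<close>

lemma split_sum_covariance_nonneg:
  fixes f g :: "('a \<times> color) multiset \<Rightarrow> real"
  assumes K: "0 \<le> K" and p: "p ` {..<n} \<subseteq> space (colored lam)"
    and f: "increasing_on (configurations (colored lam)) f"
    and g: "increasing_on (configurations (colored lam)) g"
  shows "0 \<le> split_sum n (\<lambda>(a, b). (f a - f b) * (g a - g b)
    * (fifm_density D lam \<mu> K a * fifm_density D lam \<mu> K b)) p"
proof -
  define I where "I = {..<n}"
  define \<phi> where "\<phi> S = fifm_density D lam \<mu> K (config_of S)" for S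
  define w where "w S = \<phi> S * \<phi> (I - S)" for S
  define F where "F S = f (config_of S) - f (config_of (I - S))" for S
  define G where "G S = g (config_of S) - g (config_of (I - S))" for S
  have \<phi>_nonneg: "0 \<le> \<phi> S" for S
    using K by (simp add: \<phi>_def fifm_density_eq less_imp_le[OF weight_pos])
  have w_nonneg: "0 \<le> w S" for S by (simp add: w_def \<phi>_nonneg)
  have lattice: "w S * w T \<le> w (S \<union> T) * w (S \<inter> T)" for S T
  proof -
    have "\<phi> S * \<phi> T \<le> \<phi> (S \<union> T) * \<phi> (S \<inter> T)"
      unfolding \<phi>_def by (rule density_lattice[OF K])
    moreover have "\<phi> (I - S) * \<phi> (I - T) \<le> \<phi> (I - S \<inter> T) * \<phi> (I - (S \<union> T))"
      using density_lattice[OF K, of "I - S" "I - T"] by (simp add: \<phi>_def Diff_Int Diff_Un)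
    ultimately have "(\<phi> S * \<phi> T) * (\<phi> (I - S) * \<phi> (I - T))
        \<le> (\<phi> (S \<union> T) * \<phi> (S \<inter> T)) * (\<phi> (I - S \<inter> T) * \<phi> (I - (S \<union> T)))"
      by (rule mult_mono) (simp_all add: \<phi>_nonneg)
    then show ?thesis by (simp add: w_def mult_ac)
  qed
  have mono: "h (config_of S) \<le> h (config_of T)"
    if "S \<subseteq> T" "increasing_on (configurations (colored lam)) h" for h :: "_ \<Rightarrow> real" and S T
    using that config_of_mono[OF that(1)] config_of_space[OF p] by (auto simp: increasing_on_def)
  have F: "F S \<le> F T" if "S \<subseteq> T" for S T
  proof -
    have "I - T \<subseteq> I - S" using that by auto
    from mono[OF that f] mono[OF this f] show ?thesis by (simp add: F_def)
  qed
  have G: "G S \<le> G T" if "S \<subseteq> T" for S T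
  proof -
    have "I - T \<subseteq> I - S" using that by auto
    from mono[OF that g] mono[OF this g] show ?thesis by (simp add: G_def)
  qed
  have dbl: "I - (I - S) = S" if "S \<in> Pow I" for S using that by auto
  \<comment> \<open>Exchanging the two copies, \<open>S \<mapsto> I - S\<close>, preserves
    \<open>w\<close> and changes the sign of \<open>F\<close>.\<close>
  have "(\<Sum>S\<in>Pow I. w S * F S) = (\<Sum>S\<in>Pow I. - (w S * F S))"
    by (rule sum.reindex_bij_witness[of _ "\<lambda>S. I - S" "\<lambda>S. I - S"])
      (auto simp: dbl w_def F_def algebra_simps)
  then have "(\<Sum>S\<in>Pow I. w S * F S) = 0"
    by (simp add: sum_negf)
  moreover have "(\<Sum>S\<in>Pow I. w S * F S) * (\<Sum>S\<in>Pow I. w S * G S)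
      \<le> (\<Sum>S\<in>Pow I. w S * F S * G S) * (\<Sum>S\<in>Pow I. w S)"
    by (rule fkg_Pow) (simp_all add: I_def w_nonneg lattice F G)
  ultimately have prod: "0 \<le> (\<Sum>S\<in>Pow I. w S * F S * G S) * (\<Sum>S\<in>Pow I. w S)"
    by simp
  have "0 \<le> (\<Sum>S\<in>Pow I. w S * F S * G S)"
  \<comment> \<open>FKG only controls the product with the total weight. If the total is 0, every
    \<open>w S\<close> vanishes; otherwise it can be divided out.\<close>
  proof (cases "(\<Sum>S\<in>Pow I. w S) = 0")
    case True
    then have "w S = 0" if "S \<in> Pow I" for S
      using sum_nonneg_eq_0_iff[of "Pow I" w] w_nonneg that by (simp add: I_def)
    then show ?thesis by (intro sum_nonneg) simp
  next
    case False
    then have "0 < (\<Sum>S\<in>Pow I. w S)"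
      using sum_nonneg[of "Pow I" w] w_nonneg by (simp add: less_le)
    then show ?thesis using prod by (simp add: zero_le_mult_iff)
  qed
  also have "(\<Sum>S\<in>Pow I. w S * F S * G S) = split_sum n (\<lambda>(a, b). (f a - f b) * (g a - g b)
      * (fifm_density D lam \<mu> K a * fifm_density D lam \<mu> K b)) p"
    unfolding split_sum_orient by (simp add: I_def w_def F_def G_def \<phi>_def mult_ac)
  finally show ?thesis .
qed

end

end

section \<open>Passage from splittings to the covariance\<close>

text \<open>\<open>split_comparison\<close> compares nonnegative functions, so a signed
  \<open>h\<close> enters through its two parts: \<open>ennreal\<close> sends negative reals to 0,
  which makes \<open>ennreal (h z)\<close> the positive and \<open>ennreal (- h z)\<close> the
  negative part.\<close>

lemma split_sum_ennreal_parts: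
  fixes h :: "'b multiset \<times> 'b multiset \<Rightarrow> real"
  assumes "0 \<le> split_sum n h p"
  shows "split_sum n (\<lambda>z. ennreal (- h z)) p \<le> split_sum n (\<lambda>z. ennreal (h z)) p"
proof -
  have parts: "split_sum n (\<lambda>z. ennreal (k z)) p = ennreal (split_sum n (\<lambda>z. max 0 (k z)) p)" for k
  proof -
    have "ennreal (k z) = ennreal (max 0 (k z))" for z
      by (simp add: max_def ennreal_neg)
    then show ?thesis
      unfolding split_sum_def by (simp only:) (rule sum_ennreal, simp)
  qed
  have "split_sum n h p = split_sum n (\<lambda>z. max 0 (h z)) p - split_sum n (\<lambda>z. max 0 (- h z)) p"
    unfolding split_sum_def sum_subtractf[symmetric] by (intro sum.cong) (auto simp: max_def)
  with assms show ?thesis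
    unfolding parts by (intro ennreal_leI) simp
qed

lemma (in pair_sigma_finite) integrable_product_mult:
  fixes u v :: "_ \<Rightarrow> real"
  assumes u: "integrable M1 u" and v: "integrable M2 v"
  shows "integrable (M1 \<Otimes>\<^sub>M M2) (\<lambda>z. u (fst z) * v (snd z))"
    and "integral\<^sup>L (M1 \<Otimes>\<^sub>M M2) (\<lambda>z. u (fst z) * v (snd z)) = integral\<^sup>L M1 u * integral\<^sup>L M2 v"
proof -
  have [measurable]: "u \<in> borel_measurable M1" "v \<in> borel_measurable M2"
    using u v by auto
  show int: "integrable (M1 \<Otimes>\<^sub>M M2) (\<lambda>z. u (fst z) * v (snd z))"
  proof (rule Fubini_integrable)
    show "integrable M1 (\<lambda>x. \<integral>y. norm (u (fst (x, y)) * v (snd (x, y))) \<partial>M2)"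
      using u by (simp add: abs_mult)
    show "AE x in M1. integrable M2 (\<lambda>y. u (fst (x, y)) * v (snd (x, y)))"
      using v by simp
  qed measurable
  show "integral\<^sup>L (M1 \<Otimes>\<^sub>M M2) (\<lambda>z. u (fst z) * v (snd z)) = integral\<^sup>L M1 u * integral\<^sup>L M2 v"
    unfolding integral_fst'[OF int, symmetric] by simp
qed

theorem mainTheorem4:
  fixes D :: "'a::metric_space set" and lam :: "'a measure" and \<mu> K :: real
    and \<nu> :: "('a \<times> color) list measure" and P :: "('a \<times> color) multiset measure"
    and M :: "'w measure" and \<eta> :: "'w \<Rightarrow> ('a \<times> color) multiset"
    and f g :: "('a \<times> color) multiset \<Rightarrow> real"
  assumes "compact D" and "radon_measure_on D lam" and "\<mu> > 0"
    and stationary: "fifm_stationary D lam \<mu> \<nu>"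
    and "prob_space M" and "\<eta> \<in> measurable M (config_space (colored lam))"
    and law: "distr M (config_space (colored lam)) \<eta> = distr \<nu> (config_space (colored lam)) mset"
    and poisson: "poisson_point_process (colored lam) P"
    and density: "distr M (config_space (colored lam)) \<eta>
                    = density P (\<lambda>\<gamma>. ennreal (fifm_density D lam \<mu> K \<gamma>))"
    and "f \<in> borel_measurable (config_space (colored lam))"
    and "g \<in> borel_measurable (config_space (colored lam))"
    and "increasing_on (configurations (colored lam)) f"
    and "increasing_on (configurations (colored lam)) g"
    and "integrable M (\<lambda>\<omega>. f (\<eta> \<omega>))" and "integrable M (\<lambda>\<omega>. g (\<eta> \<omega>))"
    and "integrable M (\<lambda>\<omega>. f (\<eta> \<omega>) * g (\<eta> \<omega>))"
  shows "prob_space.expectation M (\<lambda>\<omega>. f (\<eta> \<omega>) * g (\<eta> \<omega>))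
           \<ge> prob_space.expectation M (\<lambda>\<omega>. f (\<eta> \<omega>)) * prob_space.expectation M (\<lambda>\<omega>. g (\<eta> \<omega>))"
proof -
  interpret matching_space D lam \<mu>
    using assms(1-3) by unfold_locales
  interpret finite_poisson "colored lam" P
    using poisson by unfold_locales
  interpret M: prob_space M by fact
  let ?C = "config_space (colored lam)"
  define \<phi> where "\<phi> = fifm_density D lam \<mu> K"
  have [measurable]: "\<phi> \<in> borel_measurable ?C"
    unfolding \<phi>_def by (rule measurable_fifm_density)
  note assms(6,10,11)[measurable]
  have law_eq: "distr M ?C \<eta> = density P (\<lambda>\<gamma>. ennreal (\<phi> \<gamma>))"
    using density by (simp add: \<phi>_def)
  \<comment> \<open>The sign of \<open>K\<close> follows from normalization: for negative
    \<open>K\<close> the density would be 0 in \<open>ennreal\<close>, and the law would have total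
    mass 0.\<close>
  have K: "0 \<le> K"
  proof (rule ccontr)
    assume "\<not> 0 \<le> K"
    then have "ennreal (\<phi> \<gamma>) = 0" for \<gamma>
      using weight_pos[of \<gamma>] by (auto simp: \<phi>_def fifm_density_eq ennreal_eq_0_iff mult_nonpos_nonneg)
    then have "emeasure (distr M ?C \<eta>) (space ?C) = 0"
      unfolding law_eq by (simp add: emeasure_density sets.top[of ?C, simplified] sets_P)
    moreover have "emeasure (distr M ?C \<eta>) (space ?C) = 1"
      using prob_space.emeasure_space_1[OF M.prob_space_distr[of \<eta> ?C]] by simp
    ultimately show False by simp
  qed
  then have \<phi>_nonneg: "0 \<le> \<phi> \<gamma>" for \<gamma>
    by (simp add: \<phi>_def fifm_density_eq less_imp_le[OF weight_pos])
  have expect: "M.expectation (\<lambda>\<omega>. u (\<eta> \<omega>)) = (\<integral>\<gamma>. \<phi> \<gamma> * u \<gamma> \<partial>P)"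
    and integrable: "integrable M (\<lambda>\<omega>. u (\<eta> \<omega>)) \<Longrightarrow> integrable P (\<lambda>\<gamma>. \<phi> \<gamma> * u \<gamma>)"
    if [measurable]: "u \<in> borel_measurable ?C" for u :: "_ \<Rightarrow> real"
  proof -
    have "M.expectation (\<lambda>\<omega>. u (\<eta> \<omega>)) = integral\<^sup>L (distr M ?C \<eta>) u"
      by (rule integral_distr[symmetric]) measurable
    also have "\<dots> = (\<integral>\<gamma>. \<phi> \<gamma> *\<^sub>R u \<gamma> \<partial>P)"
      unfolding law_eq by (rule integral_density) (auto simp: \<phi>_nonneg)
    finally show "M.expectation (\<lambda>\<omega>. u (\<eta> \<omega>)) = (\<integral>\<gamma>. \<phi> \<gamma> * u \<gamma> \<partial>P)" by simp
    assume "integrable M (\<lambda>\<omega>. u (\<eta> \<omega>))"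
    then have "integrable (distr M ?C \<eta>) u"
      by (subst integrable_distr_eq) auto
    then show "integrable P (\<lambda>\<gamma>. \<phi> \<gamma> * u \<gamma>)"
      unfolding law_eq by (subst (asm) integrable_density) (auto simp: \<phi>_nonneg)
  qed
  \<comment> \<open>The constant observable 1 shows that \<open>\<phi>\<close> is integrable with
    integral 1.\<close>
  have "M.expectation (\<lambda>\<omega>. 1) = (\<integral>\<gamma>. \<phi> \<gamma> * 1 \<partial>P)"
    by (rule expect) simp
  moreover have "integrable P (\<lambda>\<gamma>. \<phi> \<gamma> * 1)"
    by (rule integrable) simp_all
  ultimately have one: "(\<integral>\<gamma>. \<phi> \<gamma> \<partial>P) = 1" "integrable P \<phi>"
    by (simp_all add: M.prob_space)
  define u where "u = (\<lambda>\<gamma>. \<phi> \<gamma> * f \<gamma>)"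
  define v where "v = (\<lambda>\<gamma>. \<phi> \<gamma> * g \<gamma>)"
  define w where "w = (\<lambda>\<gamma>. \<phi> \<gamma> * (f \<gamma> * g \<gamma>))"
  have int: "integrable P u" "integrable P v" "integrable P w"
    unfolding u_def v_def w_def using assms(14-16) by (auto intro: integrable)
  define h where "h = (\<lambda>(a, b). (f a - f b) * (g a - g b) * (\<phi> a * \<phi> b))"
  \<comment> \<open>Each of the four products has integrable factors, so \<open>h\<close> is
    integrable although \<open>f\<close> and \<open>g\<close> may be unbounded.\<close>
  have h_eq: "h = (\<lambda>z. w (fst z) * \<phi> (snd z) - u (fst z) * v (snd z)
      - v (fst z) * u (snd z) + \<phi> (fst z) * w (snd z))"
    by (auto simp: h_def u_def v_def w_def algebra_simps)
  note prods = PP.integrable_product_mult[OF int(3) one(2)] PP.integrable_product_mult[OF int(1,2)]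
    PP.integrable_product_mult[OF int(2,1)] PP.integrable_product_mult[OF one(2) int(3)]
  have h_int: "integrable (P \<Otimes>\<^sub>M P) h"
    unfolding h_eq using prods by auto
  \<comment> \<open>The diagonal terms each give the integral of \<open>w\<close>, since
    \<open>\<phi>\<close> has integral 1; the cross terms each give the product of those of
    \<open>u\<close> and \<open>v\<close>.\<close>
  have h_integral: "integral\<^sup>L (P \<Otimes>\<^sub>M P) h = 2 * (integral\<^sup>L P w - integral\<^sup>L P u * integral\<^sup>L P v)"
    unfolding h_eq using prods by (simp add: one)
  have [measurable]: "h \<in> borel_measurable (?C \<Otimes>\<^sub>M ?C)"
    unfolding h_def by measurable
  have "(\<integral>\<^sup>+z. ennreal (- h z) \<partial>(P \<Otimes>\<^sub>M P)) \<le> (\<integral>\<^sup>+z. ennreal (h z) \<partial>(P \<Otimes>\<^sub>M P))"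
  proof (rule split_comparison)
    fix n :: nat and p :: "nat \<Rightarrow> 'a \<times> color" assume "p ` {..<n} \<subseteq> space (colored lam)"
    from split_sum_covariance_nonneg[OF K this assms(12,13)]
    have "0 \<le> split_sum n h p" by (simp add: h_def \<phi>_def)
    then show "split_sum n (\<lambda>z. ennreal (- h z)) p \<le> split_sum n (\<lambda>z. ennreal (h z)) p"
      by (rule split_sum_ennreal_parts)
  qed measurable
  \<comment> \<open>Finiteness is needed to return to reals: \<open>enn2real\<close> sends infinity
    to 0 and is monotone only below a finite bound.\<close>
  moreover have "(\<integral>\<^sup>+z. ennreal (h z) \<partial>(P \<Otimes>\<^sub>M P)) < \<top>"
    using h_int by (simp add: real_integrable_def less_top)
  ultimately have "0 \<le> integral\<^sup>L (P \<Otimes>\<^sub>M P) h"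
    unfolding real_lebesgue_integral_def[OF h_int] by (simp add: enn2real_mono)
  then have "integral\<^sup>L P u * integral\<^sup>L P v \<le> integral\<^sup>L P w"
    unfolding h_integral by simp
  then show ?thesis
    using expect[of f] expect[of g] expect[of "\<lambda>\<gamma>. f \<gamma> * g \<gamma>"]
    by (simp add: u_def v_def w_def)
qed

end
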